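(* Let $n\ge 2$ and let $\sigma\in VB_n/\Gamma_2(VP_n)$. Let $\theta=\overline{\pi}_p(\sigma)^{-1}$ and let $T_\theta$ be a transversal of the action of $\sigma$ on $\{\lambda_{i,j}\mid 1\le i\ne j\le n\}$. Then for all integers $a_{i,j}$ ($1\le i\neq j\le n$), the elements $$\prod_{1\le i\ne j\le n}\lambda_{i,j}^{a_{i,j}}\,\sigma\qquad\text{and}\qquad\prod_{\lambda_{i_q,j_q}\in T_\theta}\lambda_{i_q,j_q}^{S_{i_q,j_q}}\,\sigma$$ are conjugate in $VB_n/\Gamma_2(VP_n)$, where $S_{i_q,j_q}=\sum_{\lambda_{r,s}\in\mathcal{O}_\theta(\lambda_{i_q,j_q})}a_{r,s}$ for all $\lambda_{i_q,j_q}\in T_\theta$.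
   Context: Permutations are composed left to right: $\sigma\tau(x)=\tau(\sigma(x))$. $\Gamma_2(H)=[H,H]$. $VB_n$ is the group with generators $\sigma_i,\rho_i$ ($1\le i\le n-1$) and relations: $\sigma_i\sigma_{i+1}\sigma_i=\sigma_{i+1}\sigma_i\sigma_{i+1}$, $\rho_i\rho_{i+1}\rho_i=\rho_{i+1}\rho_i\rho_{i+1}$, $\rho_i\rho_{i+1}\sigma_i=\sigma_{i+1}\rho_i\rho_{i+1}$ for $1\le i\le n-2$; $\rho_i^2=1$; and $\sigma_i\sigma_j=\sigma_j\sigma_i$, $\rho_i\rho_j=\rho_j\rho_i$, $\sigma_i\rho_j=\rho_j\sigma_i$ for $|i-j|\ge 2$. $VP_n$ is the kernel of $\pi_p\colon VB_n\to S_n$, $\sigma_i,\rho_i\mapsto(i,i+1)$, and $\overline{\pi}_p\colon VB_n/\Gamma_2(VP_n)\to S_n$ is the induced map. Put $\lambda_{i,i+1}=\rho_i\sigma_i^{-1}$, $\lambda_{i+1,i}=\sigma_i^{-1}\rho_i$, and for $j>i+1$, $\lambda_{i,j}=w\lambda_{i,i+1}w^{-1}$, $\lambda_{j,i}=w\lambda_{i+1,i}w^{-1}$ with $w=\rho_{j-1}\rho_{j-2}\cdots\rho_{i+1}$. It is known that $VP_n/\Gamma_2(VP_n)$ is free Abelian with basis the (classes of the) $\lambda_{i,j}$, $1\le i\neq j\le n$, and that for $\nu\in VB_n/\Gamma_2(VP_n)$ with $\theta=\overline{\pi}_p(\nu)^{-1}$ one has $\nu\lambda_{i,j}\nu^{-1}=\lambda_{\theta(i),\theta(j)}$.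 The action of $\nu$ on the $\lambda_{i,j}$ is the conjugation action of $\langle\nu\rangle$, $\mathcal{O}_\theta(\lambda_{i,j})=\{\lambda_{\theta^k(i),\theta^k(j)}\mid k\in\mathbb{Z}\}$ is the orbit of $\lambda_{i,j}$, and a transversal is a set with exactly one representative of each orbit. *)

theory Defs
  imports "HOL-Algebra.FiniteProduct" "HOL-Algebra.Group_Action" "HOL-Algebra.Sym_Groups"
begin

section \<open>Groups given by generators and relations\<close>

text \<open>A letter \<open>(x, True)\<close> stands for the generator \<open>x\<close> and \<open>(x, False)\<close> for its formal
  inverse. A relation is a pair of words to be identified.\<close>

type_synonym 'g word = "('g \<times> bool) list"

definition words_over :: "'g set \<Rightarrow> 'g word set"
  where "words_over S = lists (S \<times> UNIV)"

inductive_set word_rel :: "'g set \<Rightarrow> ('g word \<times> 'g word) set \<Rightarrow> ('g word \<times> 'g word) set"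
  for S R where
    refl: "u \<in> words_over S \<Longrightarrow> (u, u) \<in> word_rel S R"
  | sym: "(u, v) \<in> word_rel S R \<Longrightarrow> (v, u) \<in> word_rel S R"
  | trans: "(u, v) \<in> word_rel S R \<Longrightarrow> (v, w) \<in> word_rel S R \<Longrightarrow> (u, w) \<in> word_rel S R"
  | append: "(u, v) \<in> word_rel S R \<Longrightarrow> (u', v') \<in> word_rel S R \<Longrightarrow> (u @ u', v @ v') \<in> word_rel S R"
  | cancel: "x \<in> S \<Longrightarrow> ([(x, b), (x, \<not> b)], []) \<in> word_rel S R"
  | relation: "(u, v) \<in> R \<Longrightarrow> (u, v) \<in> word_rel S R"

definition presented_group :: "'g set \<Rightarrow> ('g word \<times> 'g word) set \<Rightarrow> 'g word set monoid"
  where "presented_group S R =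
    \<lparr> carrier = words_over S // word_rel S R,
      monoid.mult = (\<lambda>A B. \<Union>u\<in>A. \<Union>v\<in>B. word_rel S R `` {u @ v}),
      one = word_rel S R `` {[]} \<rparr>"

definition presented_gen :: "'g set \<Rightarrow> ('g word \<times> 'g word) set \<Rightarrow> 'g \<Rightarrow> 'g word set"
  where "presented_gen S R x = word_rel S R `` {[(x, True)]}"

definition word_eval :: "('a, 'b) monoid_scheme \<Rightarrow> ('g \<Rightarrow> 'a) \<Rightarrow> 'g word \<Rightarrow> 'a"
  where "word_eval G f w =
    foldr (\<lambda>(x, b) y. (if b then f x else inv\<^bsub>G\<^esub> (f x)) \<otimes>\<^bsub>G\<^esub> y) w \<one>\<^bsub>G\<^esub>"

text \<open>The homomorphism out of a presented group determined by the images of the generators; it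
  makes sense when these images satisfy the relations, see \<open>presented_lift_hom\<close> below.\<close>

definition presented_lift :: "('a, 'b) monoid_scheme \<Rightarrow> ('g \<Rightarrow> 'a) \<Rightarrow> 'g word set \<Rightarrow> 'a"
  where "presented_lift G f X = the_elem (word_eval G f ` X)"

lemma word_rel_words:
  assumes "R \<subseteq> words_over S \<times> words_over S" "(u, v) \<in> word_rel S R"
  shows "u \<in> words_over S \<and> v \<in> words_over S"
  using assms(2) by induction (use assms(1) in \<open>auto simp: words_over_def\<close>)

lemma word_rel_equiv:
  assumes "R \<subseteq> words_over S \<times> words_over S"
  shows "equiv (words_over S) (word_rel S R)"
proof (rule equivI)
  show "word_rel S R \<subseteq> words_over S \<times> words_over S"
    using word_rel_words[OF assms] by auto
  show "refl_on (words_over S) (word_rel S R)"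
    by (auto simp: refl_on_def intro: word_rel.refl)
  show "sym (word_rel S R)"
    by (auto simp: sym_def intro: word_rel.sym)
  show "trans (word_rel S R)"
    by (auto simp: trans_def intro: word_rel.trans)
qed

lemma presented_mult_class:
  assumes R: "R \<subseteq> words_over S \<times> words_over S" and "u \<in> words_over S" "v \<in> words_over S"
  shows "(word_rel S R `` {u}) \<otimes>\<^bsub>presented_group S R\<^esub> (word_rel S R `` {v}) = word_rel S R `` {u @ v}"
proof -
  let ?c = "\<lambda>w. word_rel S R `` {w}"
  have eq: "?c (u' @ v') = ?c (u @ v)" if "u' \<in> ?c u" "v' \<in> ?c v" for u' v'
    using equiv_class_eq[OF word_rel_equiv[OF R] word_rel.append[of u u' S R v v']] that by simp
  have "(\<Union>u'\<in>?c u. \<Union>v'\<in>?c v. ?c (u' @ v')) = (\<Union>u'\<in>?c u. \<Union>v'\<in>?c v. ?c (u @ v))"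
    by (intro SUP_cong HOL.refl eq)
  moreover have "u \<in> ?c u" "v \<in> ?c v"
    using assms by (auto intro: word_rel.refl)
  then have "?c u \<noteq> {}" "?c v \<noteq> {}" by blast+
  ultimately show ?thesis
    by (simp add: presented_group_def)
qed

lemma word_rel_inverse:
  assumes "u \<in> words_over S"
  shows "(map (\<lambda>(x, b). (x, \<not> b)) (rev u) @ u, []) \<in> word_rel S R"
  using assms
proof (induction u)
  case Nil
  then show ?case by (auto intro: word_rel.refl simp: words_over_def)
next
  case (Cons a u)
  obtain x b where a: "a = (x, b)" by fastforce
  have u: "u \<in> words_over S" "x \<in> S" using Cons.prems a by (auto simp: words_over_def)
  let ?i = "map (\<lambda>(x, b). (x, \<not> b)) (rev u)"
  have i: "?i \<in> words_over S" using u by (fastforce simp: words_over_def in_lists_conv_set)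
  have "([(x, \<not> b), (x, b)], []) \<in> word_rel S R"
    using word_rel.cancel[OF u(2), of "\<not> b"] by simp
  then have "([(x, \<not> b), (x, b)] @ u, [] @ u) \<in> word_rel S R"
    by (rule word_rel.append[OF _ word_rel.refl[OF u(1)]])
  then have "(?i @ ([(x, \<not> b), (x, b)] @ u), ?i @ ([] @ u)) \<in> word_rel S R"
    by (rule word_rel.append[OF word_rel.refl[OF i]])
  then have "(?i @ [(x, \<not> b), (x, b)] @ u, []) \<in> word_rel S R"
    using Cons.IH[OF u(1)] by (auto intro: word_rel.trans)
  then show ?case by (simp add: a)
qed

lemma presented_group_group:
  assumes R: "R \<subseteq> words_over S \<times> words_over S"
  shows "group (presented_group S R)"
proof -
  let ?G = "presented_group S R"
  let ?c = "\<lambda>u. word_rel S R `` {u}"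
  have car: "X \<in> carrier ?G \<longleftrightarrow> (\<exists>u \<in> words_over S. X = ?c u)" for X
    by (auto simp: presented_group_def quotient_def)
  have one: "\<one>\<^bsub>?G\<^esub> = ?c []" by (simp add: presented_group_def)
  have app: "u @ v \<in> words_over S" if "u \<in> words_over S" "v \<in> words_over S" for u v
    using that by (auto simp: words_over_def)
  have nil: "[] \<in> words_over S" by (simp add: words_over_def)
  note m = presented_mult_class[OF R]
  show ?thesis
  proof (rule groupI)
    fix X Y assume "X \<in> carrier ?G" "Y \<in> carrier ?G"
    then show "X \<otimes>\<^bsub>?G\<^esub> Y \<in> carrier ?G" using m app unfolding car by metis
  next
    show "\<one>\<^bsub>?G\<^esub> \<in> carrier ?G" using one nil unfolding car by blast
  next
    fix X Y Z assume "X \<in> carrier ?G" "Y \<in> carrier ?G" "Z \<in> carrier ?G"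
    then show "X \<otimes>\<^bsub>?G\<^esub> Y \<otimes>\<^bsub>?G\<^esub> Z = X \<otimes>\<^bsub>?G\<^esub> (Y \<otimes>\<^bsub>?G\<^esub> Z)"
      unfolding car using m app by (auto simp: app)
  next
    fix X assume "X \<in> carrier ?G"
    then show "\<one>\<^bsub>?G\<^esub> \<otimes>\<^bsub>?G\<^esub> X = X" unfolding car one using m nil by auto
  next
    fix X assume "X \<in> carrier ?G"
    then obtain u where u: "u \<in> words_over S" "X = ?c u" using car by auto
    let ?i = "map (\<lambda>(x, b). (x, \<not> b)) (rev u)"
    have i: "?i \<in> words_over S" using u by (fastforce simp: words_over_def in_lists_conv_set)
    have "?c ?i \<otimes>\<^bsub>?G\<^esub> X = \<one>\<^bsub>?G\<^esub>"
      using m[OF i u(1)] equiv_class_eq[OF word_rel_equiv[OF R] word_rel_inverse[OF u(1)]]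
      by (simp add: u(2) one)
    then show "\<exists>Y\<in>carrier ?G. Y \<otimes>\<^bsub>?G\<^esub> X = \<one>\<^bsub>?G\<^esub>" using i car by blast
  qed
qed

lemma (in group) word_eval_closed:
  assumes "f \<in> S \<rightarrow> carrier G" "w \<in> words_over S"
  shows "word_eval G f w \<in> carrier G"
  using assms(2) by (induction w) (use assms(1) in \<open>auto simp: word_eval_def words_over_def Pi_iff\<close>)

lemma (in group) word_eval_append:
  assumes "f \<in> S \<rightarrow> carrier G" "u \<in> words_over S" "v \<in> words_over S"
  shows "word_eval G f (u @ v) = word_eval G f u \<otimes> word_eval G f v"
  using assms(2)
proof (induction u)
  case Nil
  then show ?case using word_eval_closed[OF assms(1,3)] by (simp add: word_eval_def)
next
  case (Cons a u)
  obtain x b where a: "a = (x, b)" by fastforce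
  have u: "u \<in> words_over S" "f x \<in> carrier G"
    using Cons.prems a assms(1) by (auto simp: words_over_def)
  have c: "word_eval G f (a # w) = (if b then f x else inv (f x)) \<otimes> word_eval G f w" for w
    by (simp add: word_eval_def a)
  show ?case
    using Cons.IH[OF u(1)] u(2) word_eval_closed[OF assms(1) u(1)] word_eval_closed[OF assms(1,3)]
    by (simp add: c m_assoc)
qed

lemma (in group) word_eval_rel:
  assumes R: "R \<subseteq> words_over S \<times> words_over S" and f: "f \<in> S \<rightarrow> carrier G"
    and "\<And>u v. (u, v) \<in> R \<Longrightarrow> word_eval G f u = word_eval G f v"
    and "(u, v) \<in> word_rel S R"
  shows "word_eval G f u = word_eval G f v"
  using assms(4)
proof induction
  case (append u v u' v')
  then show ?case
    using word_rel_words[OF R append.hyps(1)] word_rel_words[OF R append.hyps(2)]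
    by (simp add: word_eval_append[OF f])
next
  case (cancel x b)
  then show ?case using f by (auto simp: word_eval_def Pi_iff)
qed (use assms(3) in auto)

lemma (in group) presented_lift_class:
  assumes R: "R \<subseteq> words_over S \<times> words_over S" and f: "f \<in> S \<rightarrow> carrier G"
    and rel: "\<And>u v. (u, v) \<in> R \<Longrightarrow> word_eval G f u = word_eval G f v"
    and u: "u \<in> words_over S"
  shows "presented_lift G f (word_rel S R `` {u}) = word_eval G f u"
proof -
  have "word_eval G f ` (word_rel S R `` {u}) = {word_eval G f u}"
    using word_eval_rel[OF R f rel] word_rel.refl[OF u] by (auto simp: image_iff)
  then show ?thesis by (simp add: presented_lift_def)
qed

lemma (in group) presented_lift_hom:
  assumes R: "R \<subseteq> words_over S \<times> words_over S" and f: "f \<in> S \<rightarrow> carrier G"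
    and rel: "\<And>u v. (u, v) \<in> R \<Longrightarrow> word_eval G f u = word_eval G f v"
  shows "presented_lift G f \<in> hom (presented_group S R) G"
proof -
  have app: "u @ v \<in> words_over S" if "u \<in> words_over S" "v \<in> words_over S" for u v
    using that by (auto simp: words_over_def)
  have car: "X \<in> carrier (presented_group S R) \<longleftrightarrow> (\<exists>u \<in> words_over S. X = word_rel S R `` {u})" for X
    by (auto simp: presented_group_def quotient_def)
  note l = presented_lift_class[OF R f rel]
  show ?thesis
  proof (rule homI)
    fix X assume "X \<in> carrier (presented_group S R)"
    then show "presented_lift G f X \<in> carrier G"
      unfolding car using l word_eval_closed[OF f] by auto
  next
    fix X Y assume "X \<in> carrier (presented_group S R)" "Y \<in> carrier (presented_group S R)"
    then show "presented_lift G f (X \<otimes>\<^bsub>presented_group S R\<^esub> Y)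
        = presented_lift G f X \<otimes> presented_lift G f Y"
      unfolding car using l app word_eval_append[OF f] presented_mult_class[OF R] by auto
  qed
qed

lemma (in group) presented_lift_gen:
  assumes "R \<subseteq> words_over S \<times> words_over S" "f \<in> S \<rightarrow> carrier G"
    and "\<And>u v. (u, v) \<in> R \<Longrightarrow> word_eval G f u = word_eval G f v" and x: "x \<in> S"
  shows "presented_lift G f (presented_gen S R x) = f x"
proof -
  have w: "[(x, True)] \<in> words_over S" using x by (simp add: words_over_def)
  show ?thesis
    using presented_lift_class[OF assms(1-3) w] x assms(2)
    by (auto simp: presented_gen_def word_eval_def Pi_iff)
qed

section \<open>The virtual braid group\<close>

datatype vgen = Sg nat | Rh nat

definition vb_gens :: "nat \<Rightarrow> vgen set"
  where "vb_gens n = Sg ` {1..<n} \<union> Rh ` {1..<n}"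

abbreviation sg :: "nat \<Rightarrow> vgen \<times> bool" where "sg i \<equiv> (Sg i, True)"
abbreviation rh :: "nat \<Rightarrow> vgen \<times> bool" where "rh i \<equiv> (Rh i, True)"

definition vb_rels :: "nat \<Rightarrow> (vgen word \<times> vgen word) set"
  where "vb_rels n =
      {([sg i, sg (i+1), sg i], [sg (i+1), sg i, sg (i+1)]) | i. 1 \<le> i \<and> i + 1 < n}
    \<union> {([rh i, rh (i+1), rh i], [rh (i+1), rh i, rh (i+1)]) | i. 1 \<le> i \<and> i + 1 < n}
    \<union> {([rh i, rh (i+1), sg i], [sg (i+1), rh i, rh (i+1)]) | i. 1 \<le> i \<and> i + 1 < n}
    \<union> {([rh i, rh i], []) | i. i \<in> {1..<n}}
    \<union> {([sg i, sg j], [sg j, sg i]) | i j. i \<in> {1..<n} \<and> j \<in> {1..<n} \<and> \<bar>int i - int j\<bar> \<ge> 2}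
    \<union> {([rh i, rh j], [rh j, rh i]) | i j. i \<in> {1..<n} \<and> j \<in> {1..<n} \<and> \<bar>int i - int j\<bar> \<ge> 2}
    \<union> {([sg i, rh j], [rh j, sg i]) | i j. i \<in> {1..<n} \<and> j \<in> {1..<n} \<and> \<bar>int i - int j\<bar> \<ge> 2}"

definition VB :: "nat \<Rightarrow> vgen word set monoid"
  where "VB n = presented_group (vb_gens n) (vb_rels n)"

definition vb_sigma :: "nat \<Rightarrow> nat \<Rightarrow> vgen word set"
  where "vb_sigma n i = presented_gen (vb_gens n) (vb_rels n) (Sg i)"

definition vb_rho :: "nat \<Rightarrow> nat \<Rightarrow> vgen word set"
  where "vb_rho n i = presented_gen (vb_gens n) (vb_rels n) (Rh i)"

text \<open>The symmetric group on \<open>{1..n}\<close> with permutations composed from left to right, i.e. the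
  opposite of \<^const>\<open>sym_group\<close>.\<close>

definition sym_group_lr :: "nat \<Rightarrow> (nat \<Rightarrow> nat) monoid"
  where "sym_group_lr n = (sym_group n)\<lparr>monoid.mult := (\<lambda>p q. q \<circ> p)\<rparr>"

fun vgen_perm :: "vgen \<Rightarrow> nat \<Rightarrow> nat" where
  "vgen_perm (Sg i) = transpose i (i + 1)"
| "vgen_perm (Rh i) = transpose i (i + 1)"

definition pi_p :: "nat \<Rightarrow> vgen word set \<Rightarrow> nat \<Rightarrow> nat"
  where "pi_p n = presented_lift (sym_group_lr n) vgen_perm"

definition VP :: "nat \<Rightarrow> vgen word set set"
  where "VP n = kernel (VB n) (sym_group_lr n) (pi_p n)"

definition Gamma2_VP :: "nat \<Rightarrow> vgen word set set"
  where "Gamma2_VP n = derived (VB n) (VP n)"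

definition VBq :: "nat \<Rightarrow> vgen word set set monoid"
  where "VBq n = VB n Mod Gamma2_VP n"

text \<open>\<open>VP\<^sub>n / \<Gamma>\<^sub>2(VP\<^sub>n)\<close>; its elements are the same cosets as those of \<open>VBq n\<close> that are contained
  in \<open>VP n\<close>, and its operation is the restriction of the operation of \<open>VBq n\<close>.\<close>

definition VPq :: "nat \<Rightarrow> vgen word set set monoid"
  where "VPq n = ((VB n)\<lparr>carrier := VP n\<rparr>) Mod Gamma2_VP n"

definition pi_bar :: "nat \<Rightarrow> vgen word set set \<Rightarrow> nat \<Rightarrow> nat"
  where "pi_bar n X = the_elem (pi_p n ` X)"

lemma vb_rels_words: "vb_rels n \<subseteq> words_over (vb_gens n) \<times> words_over (vb_gens n)"
  by (auto simp: vb_rels_def vb_gens_def words_over_def)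

lemma VB_group: "group (VB n)"
  unfolding VB_def by (rule presented_group_group[OF vb_rels_words])

lemma sym_group_lr_group: "group (sym_group_lr n)"
proof (rule groupI)
  fix p assume p: "p \<in> carrier (sym_group_lr n)"
  then have "inv' p \<in> carrier (sym_group_lr n)" "inv' p \<otimes>\<^bsub>sym_group_lr n\<^esub> p = \<one>\<^bsub>sym_group_lr n\<^esub>"
    by (auto simp: sym_group_lr_def sym_group_def permutes_inv permutes_inv_o)
  then show "\<exists>q\<in>carrier (sym_group_lr n). q \<otimes>\<^bsub>sym_group_lr n\<^esub> p = \<one>\<^bsub>sym_group_lr n\<^esub>" by blast
qed (auto simp: sym_group_lr_def sym_group_def permutes_compose permutes_id comp_assoc)

lemma vgen_perm_closed: "vgen_perm \<in> vb_gens n \<rightarrow> carrier (sym_group_lr n)"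
  by (auto simp: vb_gens_def sym_group_lr_def sym_group_def intro!: permutes_swap_id)

lemma vgen_perm_rels:
  assumes "(u, v) \<in> vb_rels n"
  shows "word_eval (sym_group_lr n) vgen_perm u = word_eval (sym_group_lr n) vgen_perm v"
  using assms unfolding vb_rels_def
  by (auto simp: word_eval_def sym_group_lr_def sym_group_def fun_eq_iff transpose_def)

lemma pi_p_hom: "group_hom (VB n) (sym_group_lr n) (pi_p n)"
  unfolding group_hom_def group_hom_axioms_def pi_p_def
  using VB_group sym_group_lr_group
    group.presented_lift_hom[OF sym_group_lr_group vb_rels_words vgen_perm_closed vgen_perm_rels]
  by (auto simp: VB_def)

lemma pi_p_gens:
  assumes "1 \<le> i" "i < n"
  shows "pi_p n (vb_sigma n i) = transpose i (i + 1)" "pi_p n (vb_rho n i) = transpose i (i + 1)"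
  using group.presented_lift_gen[OF sym_group_lr_group vb_rels_words vgen_perm_closed vgen_perm_rels]
    assms by (auto simp: pi_p_def vb_sigma_def vb_rho_def vb_gens_def)

section \<open>The generators of \<open>VP\<^sub>n / \<Gamma>\<^sub>2(VP\<^sub>n)\<close> and the conjugation action\<close>

text \<open>\<open>vb_w n i j = \<rho>\<^bsub>j-1\<^esub> \<cdots> \<rho>\<^bsub>i+1\<^esub>\<close>, which is trivial for \<open>j = i + 1\<close>.\<close>

definition vb_w :: "nat \<Rightarrow> nat \<Rightarrow> nat \<Rightarrow> vgen word set"
  where "vb_w n i j = foldr (\<lambda>k x. vb_rho n k \<otimes>\<^bsub>VB n\<^esub> x) (rev [i+1..<j]) \<one>\<^bsub>VB n\<^esub>"

definition vb_lambda :: "nat \<Rightarrow> nat \<Rightarrow> nat \<Rightarrow> vgen word set"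
  where "vb_lambda n i j =
    (if i < j
     then vb_w n i j \<otimes>\<^bsub>VB n\<^esub> (vb_rho n i \<otimes>\<^bsub>VB n\<^esub> inv\<^bsub>VB n\<^esub> (vb_sigma n i)) \<otimes>\<^bsub>VB n\<^esub> inv\<^bsub>VB n\<^esub> (vb_w n i j)
     else vb_w n j i \<otimes>\<^bsub>VB n\<^esub> (inv\<^bsub>VB n\<^esub> (vb_sigma n j) \<otimes>\<^bsub>VB n\<^esub> vb_rho n j) \<otimes>\<^bsub>VB n\<^esub> inv\<^bsub>VB n\<^esub> (vb_w n j i))"

definition lam :: "nat \<Rightarrow> nat \<Rightarrow> nat \<Rightarrow> vgen word set set"
  where "lam n i j = Gamma2_VP n #>\<^bsub>VB n\<^esub> vb_lambda n i j"

definition lam_idx :: "nat \<Rightarrow> (nat \<times> nat) set"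
  where "lam_idx n = {(i, j). i \<in> {1..n} \<and> j \<in> {1..n} \<and> i \<noteq> j}"

definition lam_set :: "nat \<Rightarrow> vgen word set set set"
  where "lam_set n = {lam n i j | i j. (i, j) \<in> lam_idx n}"

text \<open>\<open>lam_orbit n \<theta> x\<close> is \<open>\<O>\<^sub>\<theta>(x)\<close> for \<open>x = \<lambda>\<^bsub>i,j\<^esub>\<close>; the pair \<open>(i, j)\<close> is determined by \<open>x\<close>,
  since the \<open>\<lambda>\<^bsub>i,j\<^esub>\<close> form a basis.\<close>

definition lam_orbit :: "nat \<Rightarrow> (nat \<Rightarrow> nat) \<Rightarrow> vgen word set set \<Rightarrow> vgen word set set set"
  where "lam_orbit n \<theta> x =
    {lam n ((\<theta> [^]\<^bsub>sym_group_lr n\<^esub> k) i) ((\<theta> [^]\<^bsub>sym_group_lr n\<^esub> k) j) | i j (k::int).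
       (i, j) \<in> lam_idx n \<and> x = lam n i j}"

definition is_transversal :: "('a, 'c) monoid_scheme \<Rightarrow> 'b set \<Rightarrow> ('a \<Rightarrow> 'b \<Rightarrow> 'b) \<Rightarrow> 'b set \<Rightarrow> bool"
  where "is_transversal G E \<phi> T \<longleftrightarrow> T \<subseteq> E \<and> (\<forall>X \<in> orbits G E \<phi>. \<exists>!t. t \<in> T \<inter> X)"

text \<open>Transversals of the action of \<open>\<langle>\<nu>\<rangle>\<close> on the \<open>\<lambda>\<^bsub>i,j\<^esub>\<close> by conjugation.\<close>

definition lam_transversal :: "nat \<Rightarrow> vgen word set set \<Rightarrow> vgen word set set set \<Rightarrow> bool"
  where "lam_transversal n \<nu> T \<longleftrightarrow>
    is_transversal ((VBq n)\<lparr>carrier := generate (VBq n) {\<nu>}\<rparr>) (lam_set n)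
      (\<lambda>g. \<lambda>x \<in> lam_set n. g \<otimes>\<^bsub>VBq n\<^esub> x \<otimes>\<^bsub>VBq n\<^esub> inv\<^bsub>VBq n\<^esub> g) T"

definition conjugate_in :: "('a, 'b) monoid_scheme \<Rightarrow> 'a \<Rightarrow> 'a \<Rightarrow> bool"
  where "conjugate_in G x y \<longleftrightarrow> (\<exists>g \<in> carrier G. y = g \<otimes>\<^bsub>G\<^esub> x \<otimes>\<^bsub>G\<^esub> inv\<^bsub>G\<^esub> g)"

end

theory Submission
  imports Defs
begin

text \<open>Let \<open>K\<close> be the abelian normal subgroup \<open>VP\<^sub>n / \<Gamma>\<^sub>2(VP\<^sub>n)\<close> of \<open>VB\<^sub>n / \<Gamma>\<^sub>2(VP\<^sub>n)\<close>. For \<open>x\<close> and \<open>g\<close> in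
  \<open>K\<close>, conjugating \<open>x \<sigma>\<close> by \<open>g\<close> multiplies \<open>x\<close> by the commutator of \<open>g\<close> and \<open>\<sigma>\<close>. These commutators
  form a subgroup \<open>D\<close> of \<open>K\<close>, because \<open>K\<close> is abelian; hence \<open>x \<sigma>\<close> and \<open>y \<sigma>\<close> are conjugate as soon as
  \<open>x\<close> and \<open>y\<close> agree modulo \<open>D\<close>. On the other hand \<open>\<sigma>\<close> acts trivially on \<open>K / D\<close>. So in \<open>K / D\<close> every
  \<open>\<lambda>\<^bsub>i,j\<^esub>\<close> equals the representative of its orbit, and the exponents along each orbit add up. This
  argument (\<open>conjugate_collect_orbits\<close>) concerns an arbitrary abelian normal subgroup.

  What remains is to recognise the index orbits under \<open>\<theta>\<close> as the orbits of the conjugation action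
  (\<open>lam_orbit_eq\<close>), that is, to prove that every \<open>\<nu>\<close> takes \<open>\<lambda>\<^bsub>i,j\<^esub>\<close> to \<open>\<lambda>\<^bsub>\<theta>(i),\<theta>(j)\<^esub>\<close>, where \<open>\<theta>\<close> is the inverse of
  the permutation of \<open>\<nu>\<close> (\<open>lam_intertwine\<close>). For \<open>\<nu> = \<rho>\<^sub>k\<close> this is a computation with the braid and
  mixed relations of \<open>VB\<^sub>n\<close> (\<open>conj_r_transported\<close>, \<open>rho_conj_lambda\<close>); for \<open>\<nu> = \<sigma>\<^sub>k\<close> it follows because \<open>\<sigma>\<^sub>k\<close>
  and \<open>\<rho>\<^sub>k\<close> differ by an element of \<open>K\<close>, which acts trivially on \<open>K\<close>; and the relation is multiplicative
  in \<open>\<nu>\<close>.\<close>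

section \<open>Products and intertwining elements in groups\<close>

lemma (in group) inv_cancel:
  assumes "x \<in> carrier G" "y \<in> carrier G"
  shows "inv x \<otimes> (x \<otimes> y) = y" "x \<otimes> (inv x \<otimes> y) = y"
  using assms by (simp_all flip: m_assoc)

text \<open>Each factor of the product depends on its index only through the class \<open>c i\<close>, so the factors of one
  class merge into a single power. Classes that contain no index contribute the exponent \<open>0\<close>.\<close>

lemma (in comm_group) finprod_int_pow_collect:
  assumes "finite I" "finite T" "g \<in> T \<rightarrow> carrier G" "c \<in> I \<rightarrow> T"
  shows "finprod G (\<lambda>i. g (c i) [^] (a i :: int)) I
       = finprod G (\<lambda>t. g t [^] (\<Sum>i | i \<in> I \<and> c i = t. a i)) T"
  using assms(1,4)
proof (induction I)
  case empty
  then show ?case by simp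
next
  case (insert j I)
  let ?S = "\<lambda>I t. \<Sum>i | i \<in> I \<and> c i = t. a i"
  have split: "{i \<in> insert j I. c i = t} =
      (if c j = t then insert j {i \<in> I. c i = t} else {i \<in> I. c i = t})" for t
    by auto
  have S: "?S (insert j I) t = (if c j = t then a j else 0) + ?S I t" for t
    unfolding split using insert.hyps by auto
  have cj: "c j \<in> T" using insert.prems by auto
  have "finprod G (\<lambda>t. g t [^] ?S (insert j I) t) T
      = finprod G (\<lambda>t. (if c j = t then g t [^] a j else \<one>) \<otimes> g t [^] ?S I t) T"
    using assms(3) unfolding S by (intro finprod_cong') (auto simp: int_pow_mult Pi_iff)
  also have "\<dots> = finprod G (\<lambda>t. if c j = t then g t [^] a j else \<one>) T
      \<otimes> finprod G (\<lambda>t. g t [^] ?S I t) T"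
    using assms(3) by (intro finprod_multf) (auto simp: Pi_iff)
  also have "finprod G (\<lambda>t. if c j = t then g t [^] a j else \<one>) T = g (c j) [^] a j"
    using assms(3) by (intro finprod_singleton[OF cj assms(2)]) (auto simp: Pi_iff)
  finally show ?case
    using insert assms(3) by (subst finprod_insert) (auto simp: Pi_iff)
qed

lemma (in group_hom) hom_finprod:
  assumes "comm_group G" "comm_group H" "finite I" "f \<in> I \<rightarrow> carrier G"
  shows "h (finprod G f I) = finprod H (\<lambda>i. h (f i)) I"
  using assms(3,4)
proof (induction I)
  case empty
  then show ?case
    using assms by (simp add: comm_monoid.finprod_empty comm_group.axioms)
next
  case (insert j I)
  interpret G: comm_group G by fact
  interpret H: comm_group H by fact
  show ?case using insert by (subst G.finprod_insert) (auto simp: Pi_iff)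
qed

lemma (in group) intertwine_mult:
  assumes "g \<in> carrier G" "x \<in> carrier G" "y \<in> carrier G" "x' \<in> carrier G" "y' \<in> carrier G"
    and "g \<otimes> x = y \<otimes> g" "g \<otimes> x' = y' \<otimes> g"
  shows "g \<otimes> (x \<otimes> x') = (y \<otimes> y') \<otimes> g"
  using assms by (metis m_assoc)

lemma (in group) intertwine_inv:
  assumes "g \<in> carrier G" "x \<in> carrier G" "y \<in> carrier G" and "g \<otimes> x = y \<otimes> g"
  shows "g \<otimes> inv x = inv y \<otimes> g"
  using assms by (metis inv_closed inv_solve_left inv_solve_right m_assoc m_closed)

section \<open>Conjugacy in a coset of an abelian normal subgroup\<close>

text \<open>The commutator of \<open>g\<close> and \<open>\<nu>\<close>, bracketed as \<open>g\<close> times the conjugate of its inverse by \<open>\<nu>\<close>: when \<open>g\<close>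
  lies in a normal subgroup, so do both factors.\<close>

definition twist :: "('a, 'b) monoid_scheme \<Rightarrow> 'a \<Rightarrow> 'a \<Rightarrow> 'a"
  where "twist G \<nu> g = g \<otimes>\<^bsub>G\<^esub> (\<nu> \<otimes>\<^bsub>G\<^esub> inv\<^bsub>G\<^esub> g \<otimes>\<^bsub>G\<^esub> inv\<^bsub>G\<^esub> \<nu>)"

text \<open>If \<open>g\<close> commutes with \<open>x\<close>, then moving \<open>g\<close> past \<open>x\<close> in the conjugate of \<open>x \<nu>\<close> by \<open>g\<close> leaves exactly
  the commutator of \<open>g\<close> and \<open>\<nu>\<close> between \<open>x\<close> and \<open>\<nu>\<close>.\<close>

lemma (in group) conjugate_if_twist:
  assumes "g \<in> carrier G" "x \<in> carrier G" "\<nu> \<in> carrier G" "g \<otimes> x = x \<otimes> g"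
  shows "conjugate_in G (x \<otimes> \<nu>) (x \<otimes> twist G \<nu> g \<otimes> \<nu>)"
proof -
  have "g \<otimes> (x \<otimes> \<nu>) \<otimes> inv g = (g \<otimes> x) \<otimes> (\<nu> \<otimes> inv g)"
    using assms(1-3) by (simp add: m_assoc)
  also have "\<dots> = x \<otimes> twist G \<nu> g \<otimes> \<nu>"
    unfolding assms(4) using assms(1-3) by (simp add: m_assoc twist_def)
  finally show ?thesis using assms(1) unfolding conjugate_in_def by metis
qed

text \<open>An abelian normal subgroup \<open>K\<close> with an element \<open>\<nu>\<close> acting on it by conjugation. The commutators
  \<open>D\<close> of elements of \<open>K\<close> with \<open>\<nu>\<close> are what has to be divided out to make this action trivial, so \<open>K / D\<close>
  is the group of coinvariants.\<close>

locale abelian_normal = normal K G for K and G (structure) +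
  fixes \<nu>
  assumes commutative: "comm_group (G\<lparr>carrier := K\<rparr>)"
    and nu: "\<nu> \<in> carrier G"
begin

abbreviation H where "H \<equiv> G\<lparr>carrier := K\<rparr>"
abbreviation D where "D \<equiv> twist G \<nu> ` K"

sublocale H: comm_group H by (rule commutative)

lemma K_comm: "x \<in> K \<Longrightarrow> y \<in> K \<Longrightarrow> x \<otimes> y = y \<otimes> x"
  using H.m_comm by simp

lemma conj_closed: "g \<in> carrier G \<Longrightarrow> x \<in> K \<Longrightarrow> g \<otimes> x \<otimes> inv g \<in> K"
  by (rule inv_op_closed2)

text \<open>Commutation with \<open>\<nu>\<close> is an endomorphism because \<open>K\<close> is abelian; hence its image \<open>D\<close> is a subgroup.\<close>

lemma twist_hom: "group_hom H H (twist G \<nu>)"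
proof unfold_locales
  show "twist G \<nu> \<in> hom H H"
  proof (rule homI)
    fix x assume "x \<in> carrier H"
    then show "twist G \<nu> x \<in> carrier H" using conj_closed[OF nu] by (simp add: twist_def)
  next
    fix x y assume "x \<in> carrier H" "y \<in> carrier H"
    then have xy: "x \<in> K" "y \<in> K" by auto
    let ?c = "\<lambda>x. \<nu> \<otimes> inv x \<otimes> inv \<nu>"
    have c: "?c x \<in> K" "?c y \<in> K" using xy conj_closed[OF nu] by auto
    have "?c (x \<otimes> y) = ?c y \<otimes> ?c x"
      using xy nu by (simp add: inv_mult_group m_assoc inv_cancel)
    then have "twist G \<nu> (x \<otimes> y) = x \<otimes> (y \<otimes> ?c y \<otimes> ?c x)"
      using xy c by (simp add: twist_def m_assoc)
    also have "y \<otimes> ?c y \<otimes> ?c x = ?c x \<otimes> (y \<otimes> ?c y)"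
      using K_comm[of "y \<otimes> ?c y" "?c x"] xy c by simp
    finally show "twist G \<nu> (x \<otimes>\<^bsub>H\<^esub> y) = twist G \<nu> x \<otimes>\<^bsub>H\<^esub> twist G \<nu> y"
      using xy c by (simp add: twist_def m_assoc)
  qed
qed

lemma D_subgroup: "subgroup D H"
  using group_hom.img_is_subgroup[OF twist_hom] by simp

definition coinv where "coinv = (\<lambda>x. D #>\<^bsub>H\<^esub> x)"

lemma D_normal: "normal D H"
  by (rule H.subgroup_imp_normal[OF D_subgroup])

lemma coinv_hom: "group_hom H (H Mod D) coinv"
  unfolding group_hom_def group_hom_axioms_def coinv_def
  using D_normal by (simp add: normal.factorgroup_is_group normal.r_coset_hom_Mod)

lemma quotient_comm: "comm_group (H Mod D)"
  by (rule H.abelian_FactGroup[OF D_subgroup])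

lemma coinv_twist:
  assumes "x \<in> K" "d \<in> K" shows "coinv (twist G \<nu> d \<otimes> x) = coinv x"
proof -
  interpret q: group_hom H "H Mod D" coinv by (rule coinv_hom)
  have t: "twist G \<nu> d \<in> K" using assms conj_closed[OF nu] by (simp add: twist_def)
  have "coinv (twist G \<nu> d) = D"
    unfolding coinv_def using assms t H.coset_join2[OF _ D_subgroup, of "twist G \<nu> d"] by simp
  then show ?thesis
    using q.hom_mult[of "twist G \<nu> d" x] assms t q.hom_closed[of x] q.H.l_one[of "coinv x"] by simp
qed

text \<open>In the quotient by \<open>D\<close> the element \<open>\<nu>\<close> acts trivially, since \<open>x\<close> and its conjugate by \<open>\<nu>\<close> differ by the
  commutator of \<open>x\<close> and \<open>\<nu>\<close>. The same then holds for the whole cyclic group that \<open>\<nu>\<close> generates.\<close>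

lemma coinv_conj:
  assumes "g \<in> generate G {\<nu>}" "x \<in> K"
  shows "coinv (g \<otimes> x \<otimes> inv g) = coinv x"
proof -
  have 1: "coinv (\<nu> \<otimes> x \<otimes> inv \<nu>) = coinv x" if x: "x \<in> K" for x
  proof -
    let ?y = "\<nu> \<otimes> x \<otimes> inv \<nu>"
    have y: "?y \<in> K" by (rule conj_closed[OF nu x])
    have "inv ?y = \<nu> \<otimes> inv x \<otimes> inv \<nu>"
      using x nu by (simp add: inv_mult_group m_assoc)
    then have "twist G \<nu> x = x \<otimes> inv ?y"
      by (simp add: twist_def)
    then have "twist G \<nu> x \<otimes> ?y = x \<otimes> (inv ?y \<otimes> ?y)"
      using m_assoc[of x "inv ?y" ?y] mem_carrier[OF x] mem_carrier[OF y] by simp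
    then have "twist G \<nu> x \<otimes> ?y = x"
      using mem_carrier[OF x] mem_carrier[OF y] by simp
    then show ?thesis using coinv_twist[OF y x] by simp
  qed
  show ?thesis
    using assms
  proof (induction arbitrary: x)
    case one
    then show ?case by simp
  next
    case (incl h)
    then show ?case using 1 by simp
  next
    case (inv h)
    then have "\<nu> \<otimes> (inv \<nu> \<otimes> x \<otimes> \<nu>) \<otimes> inv \<nu> = x"
      using nu by (simp add: m_assoc inv_cancel)
    moreover have "inv \<nu> \<otimes> x \<otimes> \<nu> \<in> K" using inv nu inv_op_closed1 by simp
    ultimately show ?case using 1[of "inv \<nu> \<otimes> x \<otimes> \<nu>"] inv nu by simp
  next
    case (eng h1 h2)
    have h: "h1 \<in> carrier G" "h2 \<in> carrier G"
      using eng nu generate_in_carrier[of "{\<nu>}"] by auto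
    have "h1 \<otimes> h2 \<otimes> x \<otimes> inv (h1 \<otimes> h2) = h1 \<otimes> (h2 \<otimes> x \<otimes> inv h2) \<otimes> inv h1"
      using h eng.prems by (simp add: inv_mult_group m_assoc)
    then show ?case using eng conj_closed[OF h(2)] by simp
  qed
qed

text \<open>Elements of \<open>K\<close> with the same class modulo \<open>D\<close> differ by the commutator of some \<open>g \<in> K\<close> with \<open>\<nu>\<close>, and this
  \<open>g\<close> performs the conjugation.\<close>

lemma conjugate_if_coinv_eq:
  assumes "x \<in> K" "y \<in> K" "coinv x = coinv y"
  shows "conjugate_in G (x \<otimes> \<nu>) (y \<otimes> \<nu>)"
proof -
  have "y \<in> D #>\<^bsub>H\<^esub> x"
    using assms H.rcos_self[OF _ D_subgroup, of y] by (simp add: coinv_def)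
  then obtain g where g: "g \<in> K" "y = twist G \<nu> g \<otimes> x"
    by (auto simp: r_coset_def)
  have "twist G \<nu> g \<in> K" using g conj_closed[OF nu] by (simp add: twist_def)
  then have "y = x \<otimes> twist G \<nu> g" using g K_comm assms by simp
  then show ?thesis
    using conjugate_if_twist[of g x \<nu>] g assms nu K_comm by simp
qed

text \<open>Both products have the same class in the coinvariants: there each factor may be replaced by the
  representative of its orbit, after which equal bases are collected.\<close>

theorem conjugate_collect_orbits:
  assumes fin: "finite I" "finite T" and f: "f \<in> I \<rightarrow> K" and T: "T \<subseteq> K"
    and O: "\<And>t. t \<in> T \<Longrightarrow> orb t = {g \<otimes> t \<otimes> inv g | g. g \<in> generate G {\<nu>}}"
    and unique: "\<And>i. i \<in> I \<Longrightarrow> \<exists>!t. t \<in> T \<and> f i \<in> orb t"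
  shows "conjugate_in G
    (finprod H (\<lambda>i. f i [^]\<^bsub>H\<^esub> (a i :: int)) I \<otimes> \<nu>)
    (finprod H (\<lambda>t. t [^]\<^bsub>H\<^esub> (\<Sum>i | i \<in> I \<and> f i \<in> orb t. a i)) T \<otimes> \<nu>)"
proof (rule conjugate_if_coinv_eq)
  let ?Q = "H Mod D"
  let ?S = "\<lambda>t. \<Sum>i | i \<in> I \<and> f i \<in> orb t. a i"
  interpret q: group_hom H ?Q coinv by (rule coinv_hom)
  interpret Q: comm_group ?Q by (rule quotient_comm)
  have pow: "x [^]\<^bsub>H\<^esub> (k::int) \<in> K" if "x \<in> K" for x k
    using H.int_pow_closed that by simp
  have clos: "(\<lambda>i. f i [^]\<^bsub>H\<^esub> a i) \<in> I \<rightarrow> carrier H" "(\<lambda>t. t [^]\<^bsub>H\<^esub> ?S t) \<in> T \<rightarrow> carrier H"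
    using f T pow by (auto simp: Pi_iff)
  show "finprod H (\<lambda>i. f i [^]\<^bsub>H\<^esub> a i) I \<in> K" "finprod H (\<lambda>t. t [^]\<^bsub>H\<^esub> ?S t) T \<in> K"
    using H.finprod_closed[OF clos(1)] H.finprod_closed[OF clos(2)] by simp_all
  define c where "c i = (THE t. t \<in> T \<and> f i \<in> orb t)" for i
  have c: "c i \<in> T \<and> f i \<in> orb (c i)" if "i \<in> I" for i
    unfolding c_def using theI'[OF unique[OF that]] .
  have c_iff: "c i = t \<longleftrightarrow> f i \<in> orb t" if "i \<in> I" "t \<in> T" for i t
    using c[OF that(1)] unique[OF that(1)] that by blast
  have coinv_c: "coinv (f i) = coinv (c i)" if "i \<in> I" for i
  proof -
    have "f i \<in> {g \<otimes> c i \<otimes> inv g | g. g \<in> generate G {\<nu>}}"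
      using c[OF that] O by blast
    then show ?thesis using coinv_conj c[OF that] T by auto
  qed
  have coinv_T: "coinv \<in> T \<rightarrow> carrier ?Q" using q.hom_closed T by auto
  have "coinv (finprod H (\<lambda>i. f i [^]\<^bsub>H\<^esub> a i) I) = finprod ?Q (\<lambda>i. coinv (f i [^]\<^bsub>H\<^esub> a i)) I"
    by (rule q.hom_finprod[OF commutative quotient_comm fin(1) clos(1)])
  also have "\<dots> = finprod ?Q (\<lambda>i. coinv (c i) [^]\<^bsub>?Q\<^esub> a i) I"
    using coinv_T c f coinv_c by (intro Q.finprod_cong') (auto simp: q.hom_int_pow Pi_iff)
  also have "\<dots> = finprod ?Q (\<lambda>t. coinv t [^]\<^bsub>?Q\<^esub> (\<Sum>i | i \<in> I \<and> c i = t. a i)) T"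
    using c by (intro Q.finprod_int_pow_collect fin coinv_T) auto
  also have "\<dots> = finprod ?Q (\<lambda>t. coinv (t [^]\<^bsub>H\<^esub> ?S t)) T"
  proof (rule Q.finprod_cong')
    show "(\<lambda>t. coinv (t [^]\<^bsub>H\<^esub> ?S t)) \<in> T \<rightarrow> carrier ?Q" using clos(2) by (auto simp: Pi_iff)
    fix t assume t: "t \<in> T"
    then have "{i \<in> I. c i = t} = {i \<in> I. f i \<in> orb t}" using c_iff by auto
    then show "coinv t [^]\<^bsub>?Q\<^esub> (\<Sum>i | i \<in> I \<and> c i = t. a i) = coinv (t [^]\<^bsub>H\<^esub> ?S t)"
      using t T by (simp add: q.hom_int_pow subset_iff)
  qed simp
  also have "\<dots> = coinv (finprod H (\<lambda>t. t [^]\<^bsub>H\<^esub> ?S t) T)"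
    by (rule q.hom_finprod[OF commutative quotient_comm fin(2) clos(2), symmetric])
  finally show "coinv (finprod H (\<lambda>i. f i [^]\<^bsub>H\<^esub> a i) I) = coinv (finprod H (\<lambda>t. t [^]\<^bsub>H\<^esub> ?S t) T)" .
qed

end

section \<open>Conjugation by the involutions in a virtual braid group\<close>

text \<open>Involutions \<open>r i\<close> satisfying the braid relations, and elements \<open>E i\<close> that are compatible with them in the
  way in which the \<open>\<sigma>\<^sub>i\<close> are compatible with the \<open>\<rho>\<^sub>i\<close> in \<open>VB\<^sub>n\<close>. Both \<open>\<lambda>\<^bsub>i,i+1\<^esub>\<close> and \<open>\<lambda>\<^bsub>i+1,i\<^esub>\<close> have these
  properties, so the two families are treated at once.\<close>

locale mixed_braid_relations = group G for G (structure) +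
  fixes n :: nat and r E :: "nat \<Rightarrow> 'a"
  assumes r_closed: "i \<in> {1..<n} \<Longrightarrow> r i \<in> carrier G"
    and E_closed: "i \<in> {1..<n} \<Longrightarrow> E i \<in> carrier G"
    and r_sq: "i \<in> {1..<n} \<Longrightarrow> r i \<otimes> r i = \<one>"
    and r_far: "i \<in> {1..<n} \<Longrightarrow> j \<in> {1..<n} \<Longrightarrow> i + 2 \<le> j \<Longrightarrow> r i \<otimes> r j = r j \<otimes> r i"
    and r_braid: "1 \<le> i \<Longrightarrow> i + 1 < n \<Longrightarrow> r i \<otimes> r (i+1) \<otimes> r i = r (i+1) \<otimes> r i \<otimes> r (i+1)"
    and E_far: "i \<in> {1..<n} \<Longrightarrow> k \<in> {1..<n} \<Longrightarrow> \<bar>int i - int k\<bar> \<ge> 2 \<Longrightarrow> r k \<otimes> E i = E i \<otimes> r k"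
    and E_shift: "1 \<le> i \<Longrightarrow> i + 1 < n \<Longrightarrow> r i \<otimes> r (i+1) \<otimes> E i = E (i+1) \<otimes> (r i \<otimes> r (i+1))"
begin

text \<open>Conjugation by \<open>r k\<close>, which is its own inverse.\<close>

definition conj_r :: "nat \<Rightarrow> 'a \<Rightarrow> 'a" where "conj_r k x = r k \<otimes> x \<otimes> r k"

text \<open>The element \<open>E i\<close> carried from the index pair \<open>(i, i+1)\<close> to \<open>(i, j)\<close>, for \<open>i < j\<close>.\<close>

definition transported :: "nat \<Rightarrow> nat \<Rightarrow> 'a" where
  "transported i j = (let w = foldr (\<lambda>k x. r k \<otimes> x) (rev [i+1..<j]) \<one> in w \<otimes> E i \<otimes> inv w)"

lemma r_inv: "i \<in> {1..<n} \<Longrightarrow> inv (r i) = r i"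
  using r_sq r_closed by (simp add: inv_equality)

lemma conj_r_involution: "k \<in> {1..<n} \<Longrightarrow> x \<in> carrier G \<Longrightarrow> conj_r k (conj_r k x) = x"
proof -
  assume a: "k \<in> {1..<n}" "x \<in> carrier G"
  have "conj_r k (conj_r k x) = (r k \<otimes> r k) \<otimes> x \<otimes> (r k \<otimes> r k)"
    using a r_closed by (simp add: conj_r_def m_assoc)
  then show ?thesis using a r_sq by simp
qed

lemma conj_r_commute:
  assumes "i \<in> {1..<n}" "j \<in> {1..<n}" "i + 2 \<le> j" "x \<in> carrier G"
  shows "conj_r i (conj_r j x) = conj_r j (conj_r i x)"
proof -
  have "conj_r i (conj_r j x) = (r i \<otimes> r j) \<otimes> x \<otimes> (r j \<otimes> r i)"
    using assms r_closed by (simp add: conj_r_def m_assoc)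
  also have "\<dots> = (r j \<otimes> r i) \<otimes> x \<otimes> (r i \<otimes> r j)"
    using r_far[OF assms(1-3)] by simp
  also have "\<dots> = conj_r j (conj_r i x)"
    using assms r_closed by (simp add: conj_r_def m_assoc)
  finally show ?thesis .
qed

lemma conj_r_braid:
  assumes "1 \<le> i" "i + 1 < n" "x \<in> carrier G"
  shows "conj_r i (conj_r (i+1) (conj_r i x)) = conj_r (i+1) (conj_r i (conj_r (i+1) x))"
proof -
  have r: "r i \<in> carrier G" "r (i+1) \<in> carrier G" using assms r_closed by auto
  have "conj_r i (conj_r (i+1) (conj_r i x)) = (r i \<otimes> r (i+1) \<otimes> r i) \<otimes> x \<otimes> (r i \<otimes> r (i+1) \<otimes> r i)"
    using r assms by (simp add: conj_r_def m_assoc)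
  also have "\<dots> = conj_r (i+1) (conj_r i (conj_r (i+1) x))"
    unfolding r_braid[OF assms(1,2)] using r assms by (simp add: conj_r_def m_assoc)
  finally show ?thesis .
qed

lemma conj_r_E_far:
  assumes "i \<in> {1..<n}" "k \<in> {1..<n}" "\<bar>int i - int k\<bar> \<ge> 2"
  shows "conj_r k (E i) = E i"
  using E_far[OF assms] r_sq[of k] r_closed[of k] E_closed[of i] assms by (simp add: conj_r_def m_assoc)

lemma conj_r_E_shift:
  assumes "1 \<le> i" "i + 1 < n"
  shows "conj_r i (conj_r (i+1) (E i)) = E (i+1)"
proof -
  have r: "r i \<in> carrier G" "r (i+1) \<in> carrier G" "E i \<in> carrier G" "E (i+1) \<in> carrier G"
    using assms r_closed E_closed by auto
  have "conj_r i (conj_r (i+1) (E i)) = (r i \<otimes> r (i+1) \<otimes> E i) \<otimes> (r (i+1) \<otimes> r i)"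
    using r by (simp add: conj_r_def m_assoc)
  also have "\<dots> = E (i+1) \<otimes> (r i \<otimes> (r (i+1) \<otimes> r (i+1)) \<otimes> r i)"
    unfolding E_shift[OF assms] using r by (simp add: m_assoc)
  also have "\<dots> = E (i+1)"
    using r r_sq[of i] r_sq[of "i+1"] assms by simp
  finally show ?thesis .
qed

lemma w_closed:
  assumes "j \<le> n"
  shows "foldr (\<lambda>k x. r k \<otimes> x) (rev [i+1..<j]) \<one> \<in> carrier G"
  using assms
proof (induction j)
  case (Suc j)
  then show ?case using r_closed[of j] by auto
qed simp

lemma transported_base: "i \<in> {1..<n} \<Longrightarrow> transported i (Suc i) = E i"
  using E_closed by (simp add: transported_def)

lemma transported_Suc:
  assumes "1 \<le> i" "i < j" "j < n"
  shows "transported i (Suc j) = conj_r j (transported i j)"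
proof -
  let ?w = "foldr (\<lambda>k x. r k \<otimes> x) (rev [i+1..<j]) \<one>"
  have w: "?w \<in> carrier G" using w_closed[of j i] assms by simp
  have j: "r j \<in> carrier G" "E i \<in> carrier G" "inv (r j) = r j"
    using assms r_closed E_closed r_inv by auto
  have "transported i (Suc j) = (r j \<otimes> ?w) \<otimes> E i \<otimes> inv (r j \<otimes> ?w)"
    using assms by (simp add: transported_def Let_def)
  also have "\<dots> = r j \<otimes> (?w \<otimes> E i \<otimes> inv ?w) \<otimes> r j"
    using w j by (simp add: inv_mult_group m_assoc)
  finally show ?thesis by (simp add: transported_def conj_r_def Let_def)
qed

lemma transported_closed:
  assumes "1 \<le> i" "i < j" "j \<le> n"
  shows "transported i j \<in> carrier G"
  using assms w_closed[of j i] E_closed[of i] by (simp add: transported_def Let_def)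

lemma conj_r_outside:
  assumes "1 \<le> i" "Suc i \<le> j" "j \<le> n" "k \<in> {1..<n}" "k > j \<or> k + 1 < i"
  shows "conj_r k (transported i j) = transported i j"
  using assms(2,3,5)
proof (induction j rule: dec_induct)
  case base
  then show ?case using assms transported_base conj_r_E_far[of i k] by auto
next
  case (step j)
  have "conj_r k (conj_r j (transported i j)) = conj_r j (conj_r k (transported i j))"
    using conj_r_commute[of k j "transported i j"] conj_r_commute[of j k "transported i j"] step assms transported_closed[of i j] by auto
  then show ?case using step assms transported_Suc[of i j] by auto
qed

text \<open>For \<open>j = i+2\<close> this is the shift relation. The further conjugations that lead to larger \<open>j\<close> are by
  \<open>r (i+2)\<close> and later ones, and these commute with conjugation by \<open>r i\<close>.\<close>

lemma conj_r_left:
  assumes "1 \<le> i" "Suc (Suc i) \<le> j" "j \<le> n"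
  shows "conj_r i (transported i j) = transported (Suc i) j"
  using assms(2,3)
proof (induction j rule: dec_induct)
  case base
  then show ?case using assms transported_base[of i] transported_base[of "Suc i"] transported_Suc[of i "Suc i"] conj_r_E_shift[of i] by simp
next
  case (step j)
  have "conj_r i (conj_r j (transported i j)) = conj_r j (conj_r i (transported i j))"
    using conj_r_commute[of i j "transported i j"] step assms transported_closed[of i j] by auto
  then show ?case using step assms transported_Suc[of i j] transported_Suc[of "Suc i" j] by auto
qed

text \<open>For \<open>j = k+2\<close>, the three conjugations by \<open>r k\<close>, \<open>r (k+1)\<close>, \<open>r k\<close> of the element for the pair \<open>(i, k)\<close>
  may be replaced, by the braid relation, with those by \<open>r (k+1)\<close>, \<open>r k\<close>, \<open>r (k+1)\<close>, and the innermost of these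
  fixes that element. The further conjugations that lead to larger \<open>j\<close> commute with the one by \<open>r k\<close>.\<close>

lemma conj_r_inside:
  assumes "1 \<le> i" "i < k" "Suc (Suc k) \<le> j" "j \<le> n"
  shows "conj_r k (transported i j) = transported i j"
  using assms(3,4)
proof (induction j rule: dec_induct)
  case base
  have m: "transported i k \<in> carrier G" "transported i (Suc k) = conj_r k (transported i k)" "transported i (Suc (Suc k)) = conj_r (Suc k) (transported i (Suc k))"
    "conj_r (Suc k) (transported i k) = transported i k"
    using base assms transported_closed[of i k] transported_Suc[of i k] transported_Suc[of i "Suc k"] conj_r_outside[of i k "Suc k"] by auto
  then show ?case using conj_r_braid[of k "transported i k"] base assms by simp
next
  case (step j)
  have "conj_r k (conj_r j (transported i j)) = conj_r j (conj_r k (transported i j))"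
    using conj_r_commute[of k j "transported i j"] step assms transported_closed[of i j] by auto
  then show ?case using step assms transported_Suc[of i j] by auto
qed

text \<open>Conjugation by \<open>r k\<close> acts on the index pair as the transposition of \<open>k\<close> and \<open>k+1\<close>. The excluded pair
  \<open>(k, k+1)\<close> would be reversed, which leads out of the family.\<close>

lemma conj_r_transported:
  assumes "1 \<le> i" "i < j" "j \<le> n" "k \<in> {1..<n}" "\<not> (k = i \<and> j = Suc i)"
  shows "conj_r k (transported i j) = transported (transpose k (k+1) i) (transpose k (k+1) j)"
proof -
  consider "k > j" | "k + 1 < i" | "k = j" | "j = Suc k" "i < k" | "k = i" "Suc (Suc i) \<le> j"
    | "i = Suc k" | "i < k" "Suc (Suc k) \<le> j"
    using assms by linarith
  then show ?thesis
  proof cases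
    case 1 then show ?thesis using conj_r_outside[of i j k] assms by (simp add: transpose_def)
  next
    case 2 then show ?thesis using conj_r_outside[of i j k] assms by (simp add: transpose_def)
  next
    case 3 then show ?thesis using transported_Suc[of i j] assms by (simp add: transpose_def)
  next
    case 4 then show ?thesis
      using transported_Suc[of i k] conj_r_involution[of k "transported i k"] transported_closed[of i k] assms by (simp add: transpose_def)
  next
    case 5 then show ?thesis using conj_r_left[of i j] assms by (simp add: transpose_def)
  next
    case 6
    \<comment> \<open>this is the preceding case read backwards, since conjugation by \<open>r k\<close> is an involution\<close>
    then have "conj_r k (transported k j) = transported i j" using conj_r_left[of k j] assms by simp
    then show ?thesis
      using 6 conj_r_involution[of k "transported k j"] transported_closed[of k j] assms by (simp add: transpose_def)
  next
    case 7 then show ?thesis using conj_r_inside[of i k j] assms by (simp add: transpose_def)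
  qed
qed

end

section \<open>Relations in the virtual braid group\<close>

text \<open>A class of words is the product of the classes of its letters, and a negative letter is the inverse
  of a generator. This makes induction over generators available in \<open>VB\<^sub>n\<close>.\<close>

lemma presented_group_generated:
  assumes R: "R \<subseteq> words_over S \<times> words_over S"
  shows "carrier (presented_group S R) = generate (presented_group S R) (presented_gen S R ` S)"
proof -
  let ?G = "presented_group S R" and ?gen = "presented_gen S R"
  interpret group ?G by (rule presented_group_group[OF R])
  note m = presented_mult_class[OF R]
  have letter: "[(x, b)] \<in> words_over S" if "x \<in> S" for x b
    using that by (simp add: words_over_def)
  have gen: "?gen x \<in> carrier ?G" if "x \<in> S" for x
    using letter[OF that] by (auto simp: presented_group_def presented_gen_def quotient_def)
  have inv_gen: "word_rel S R `` {[(x, False)]} = inv\<^bsub>?G\<^esub> (?gen x)" if x: "x \<in> S" for x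
  proof (rule inv_equality[symmetric])
    have "word_rel S R `` {[(x, False), (x, True)]} = word_rel S R `` {[]}"
      using equiv_class_eq[OF word_rel_equiv[OF R] word_rel.cancel[OF x, where R = R and b = False]] by simp
    then show "word_rel S R `` {[(x, False)]} \<otimes>\<^bsub>?G\<^esub> ?gen x = \<one>\<^bsub>?G\<^esub>"
      using m[OF letter[OF x, of False] letter[OF x, of True]] x
      by (simp add: presented_gen_def presented_group_def)
    show "?gen x \<in> carrier ?G" by (rule gen[OF x])
    show "word_rel S R `` {[(x, False)]} \<in> carrier ?G"
      using letter[OF x] by (auto simp: presented_group_def quotient_def)
  qed
  have "word_rel S R `` {u} \<in> generate ?G (?gen ` S)" if "u \<in> words_over S" for u
    using that
  proof (induction u)
    case Nil
    then show ?case
      using generate.one[of ?G "?gen ` S"] by (simp add: presented_group_def)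
  next
    case (Cons a u)
    obtain x b where a: "a = (x, b)" by fastforce
    have x: "x \<in> S" "u \<in> words_over S" using Cons.prems by (auto simp: a words_over_def)
    have letter_gen: "word_rel S R `` {[(x, b)]} \<in> generate ?G (?gen ` S)"
      using inv_gen[OF x(1)] x(1) generate.incl[of "?gen x" "?gen ` S" ?G]
        generate.inv[of "?gen x" "?gen ` S" ?G]
      by (cases b) (auto simp: presented_gen_def)
    show ?case
      using generate.eng[OF letter_gen Cons.IH[OF x(2)]] m[OF letter[OF x(1)] x(2), of b]
      by (simp add: a)
  qed
  then have "carrier ?G \<subseteq> generate ?G (?gen ` S)"
    by (auto simp: presented_group_def quotient_def)
  then show ?thesis
    using generate_in_carrier[of "?gen ` S"] gen by blast
qed

lemma presented_rel_eq:
  assumes "R \<subseteq> words_over S \<times> words_over S" "(u, v) \<in> R"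
  shows "word_rel S R `` {u} = word_rel S R `` {v}"
  using equiv_class_eq[OF word_rel_equiv[OF assms(1)]] word_rel.relation[OF assms(2)] .

lemma VB_word2:
  assumes "x \<in> vb_gens n" "y \<in> vb_gens n"
  shows "word_rel (vb_gens n) (vb_rels n) `` {[(x, True), (y, True)]} =
    presented_gen (vb_gens n) (vb_rels n) x \<otimes>\<^bsub>VB n\<^esub> presented_gen (vb_gens n) (vb_rels n) y"
  using presented_mult_class[OF vb_rels_words, of "[(x, True)]" n "[(y, True)]"] assms
  by (simp add: presented_gen_def VB_def words_over_def)

lemma VB_word3:
  assumes "x \<in> vb_gens n" "y \<in> vb_gens n" "z \<in> vb_gens n"
  shows "word_rel (vb_gens n) (vb_rels n) `` {[(x, True), (y, True), (z, True)]} =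
    presented_gen (vb_gens n) (vb_rels n) x \<otimes>\<^bsub>VB n\<^esub> presented_gen (vb_gens n) (vb_rels n) y
      \<otimes>\<^bsub>VB n\<^esub> presented_gen (vb_gens n) (vb_rels n) z"
  using presented_mult_class[OF vb_rels_words, of "[(x, True), (y, True)]" n "[(z, True)]"]
    VB_word2[OF assms(1,2)] assms
  by (simp add: presented_gen_def VB_def words_over_def)

lemma vb_gens_closed:
  assumes "x \<in> vb_gens n"
  shows "presented_gen (vb_gens n) (vb_rels n) x \<in> carrier (VB n)"
  using assms presented_group_generated[OF vb_rels_words, of n]
  by (auto simp: VB_def intro: generate.incl)

context
  fixes n i :: nat
  assumes i: "i \<in> {1..<n}"
begin

lemma rho_closed: "vb_rho n i \<in> carrier (VB n)"
  and sigma_closed: "vb_sigma n i \<in> carrier (VB n)"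
  using i vb_gens_closed[of "Rh i" n] vb_gens_closed[of "Sg i" n]
  by (auto simp: vb_rho_def vb_sigma_def vb_gens_def)

lemma rho_square: "vb_rho n i \<otimes>\<^bsub>VB n\<^esub> vb_rho n i = \<one>\<^bsub>VB n\<^esub>"
  using presented_rel_eq[OF vb_rels_words, of "[rh i, rh i]" "[]" n] i VB_word2[of "Rh i" n "Rh i"]
  by (auto simp: vb_rels_def vb_rho_def VB_def presented_group_def vb_gens_def)

lemma far_commute:
  assumes j: "j \<in> {1..<n}" "\<bar>int i - int j\<bar> \<ge> 2"
  shows "vb_rho n i \<otimes>\<^bsub>VB n\<^esub> vb_rho n j = vb_rho n j \<otimes>\<^bsub>VB n\<^esub> vb_rho n i"
    and "vb_sigma n i \<otimes>\<^bsub>VB n\<^esub> vb_rho n j = vb_rho n j \<otimes>\<^bsub>VB n\<^esub> vb_sigma n i"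
proof -
  have g: "Rh i \<in> vb_gens n" "Rh j \<in> vb_gens n" "Sg i \<in> vb_gens n"
    using i j by (auto simp: vb_gens_def)
  have "([rh i, rh j], [rh j, rh i]) \<in> vb_rels n" "([sg i, rh j], [rh j, sg i]) \<in> vb_rels n"
    using i j unfolding vb_rels_def by blast+
  from this[THEN presented_rel_eq[OF vb_rels_words]]
  show "vb_rho n i \<otimes>\<^bsub>VB n\<^esub> vb_rho n j = vb_rho n j \<otimes>\<^bsub>VB n\<^esub> vb_rho n i"
    "vb_sigma n i \<otimes>\<^bsub>VB n\<^esub> vb_rho n j = vb_rho n j \<otimes>\<^bsub>VB n\<^esub> vb_sigma n i"
    using g by (simp_all add: VB_word2 vb_rho_def vb_sigma_def)
qed

end

lemma adjacent_relations:
  assumes "1 \<le> i" "i + 1 < n"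
  shows "vb_rho n i \<otimes>\<^bsub>VB n\<^esub> vb_rho n (i+1) \<otimes>\<^bsub>VB n\<^esub> vb_rho n i
       = vb_rho n (i+1) \<otimes>\<^bsub>VB n\<^esub> vb_rho n i \<otimes>\<^bsub>VB n\<^esub> vb_rho n (i+1)"
    and "vb_rho n i \<otimes>\<^bsub>VB n\<^esub> vb_rho n (i+1) \<otimes>\<^bsub>VB n\<^esub> vb_sigma n i
       = vb_sigma n (i+1) \<otimes>\<^bsub>VB n\<^esub> vb_rho n i \<otimes>\<^bsub>VB n\<^esub> vb_rho n (i+1)"
proof -
  have g: "Rh i \<in> vb_gens n" "Rh (i+1) \<in> vb_gens n" "Sg i \<in> vb_gens n" "Sg (i+1) \<in> vb_gens n"
    using assms by (auto simp: vb_gens_def)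
  have "([rh i, rh (i+1), rh i], [rh (i+1), rh i, rh (i+1)]) \<in> vb_rels n"
    "([rh i, rh (i+1), sg i], [sg (i+1), rh i, rh (i+1)]) \<in> vb_rels n"
    using assms unfolding vb_rels_def by blast+
  from this[THEN presented_rel_eq[OF vb_rels_words]]
  show "vb_rho n i \<otimes>\<^bsub>VB n\<^esub> vb_rho n (i+1) \<otimes>\<^bsub>VB n\<^esub> vb_rho n i
       = vb_rho n (i+1) \<otimes>\<^bsub>VB n\<^esub> vb_rho n i \<otimes>\<^bsub>VB n\<^esub> vb_rho n (i+1)"
    "vb_rho n i \<otimes>\<^bsub>VB n\<^esub> vb_rho n (i+1) \<otimes>\<^bsub>VB n\<^esub> vb_sigma n i
       = vb_sigma n (i+1) \<otimes>\<^bsub>VB n\<^esub> vb_rho n i \<otimes>\<^bsub>VB n\<^esub> vb_rho n (i+1)"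
    unfolding VB_word3[OF g(1) g(2) g(1)] VB_word3[OF g(2) g(1) g(2)]
      VB_word3[OF g(1) g(2) g(3)] VB_word3[OF g(4) g(1) g(2)] vb_rho_def vb_sigma_def
    by simp_all
qed

lemma mixed_braid_relations_VB:
  "mixed_braid_relations (VB n) n (vb_rho n) (\<lambda>i. vb_rho n i \<otimes>\<^bsub>VB n\<^esub> inv\<^bsub>VB n\<^esub> vb_sigma n i)"
  "mixed_braid_relations (VB n) n (vb_rho n) (\<lambda>i. inv\<^bsub>VB n\<^esub> vb_sigma n i \<otimes>\<^bsub>VB n\<^esub> vb_rho n i)"
proof -
  interpret group "VB n" by (rule VB_group)
  note c = rho_closed sigma_closed
  have far: "vb_rho n i \<otimes>\<^bsub>VB n\<^esub> vb_rho n j = vb_rho n j \<otimes>\<^bsub>VB n\<^esub> vb_rho n i"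
    if "i \<in> {1..<n}" "j \<in> {1..<n}" "i + 2 \<le> j" for i j
    using far_commute(1)[of i n j] that by simp
  have rr: "vb_rho n k \<otimes>\<^bsub>VB n\<^esub> vb_rho n i = vb_rho n i \<otimes>\<^bsub>VB n\<^esub> vb_rho n k"
    and rs: "vb_rho n k \<otimes>\<^bsub>VB n\<^esub> inv\<^bsub>VB n\<^esub> vb_sigma n i = inv\<^bsub>VB n\<^esub> vb_sigma n i \<otimes>\<^bsub>VB n\<^esub> vb_rho n k"
    if "i \<in> {1..<n}" "k \<in> {1..<n}" "\<bar>int i - int k\<bar> \<ge> 2" for i k
    using far_commute[OF that] intertwine_inv[of "vb_rho n k" "vb_sigma n i" "vb_sigma n i"]
      c[of i n] c[of k n] that by simp_all
  have sr: "vb_rho n i \<otimes>\<^bsub>VB n\<^esub> vb_rho n (i+1) \<otimes>\<^bsub>VB n\<^esub> vb_rho n i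
       = vb_rho n (i+1) \<otimes>\<^bsub>VB n\<^esub> (vb_rho n i \<otimes>\<^bsub>VB n\<^esub> vb_rho n (i+1))"
    and ss: "vb_rho n i \<otimes>\<^bsub>VB n\<^esub> vb_rho n (i+1) \<otimes>\<^bsub>VB n\<^esub> inv\<^bsub>VB n\<^esub> vb_sigma n i
       = inv\<^bsub>VB n\<^esub> vb_sigma n (i+1) \<otimes>\<^bsub>VB n\<^esub> (vb_rho n i \<otimes>\<^bsub>VB n\<^esub> vb_rho n (i+1))"
    if "1 \<le> i" "i + 1 < n" for i
    using adjacent_relations[OF that] c[of i n] c[of "i+1" n] that
      intertwine_inv[of "vb_rho n i \<otimes>\<^bsub>VB n\<^esub> vb_rho n (i+1)" "vb_sigma n i" "vb_sigma n (i+1)"]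
    by (simp_all add: m_assoc)
  show "mixed_braid_relations (VB n) n (vb_rho n) (\<lambda>i. vb_rho n i \<otimes>\<^bsub>VB n\<^esub> inv\<^bsub>VB n\<^esub> vb_sigma n i)"
  proof (intro mixed_braid_relations.intro VB_group mixed_braid_relations_axioms.intro)
    fix i k assume ik: "i \<in> {1..<n}" "k \<in> {1..<n}" "\<bar>int i - int k\<bar> \<ge> 2"
    show "vb_rho n k \<otimes>\<^bsub>VB n\<^esub> (vb_rho n i \<otimes>\<^bsub>VB n\<^esub> inv\<^bsub>VB n\<^esub> vb_sigma n i)
        = vb_rho n i \<otimes>\<^bsub>VB n\<^esub> inv\<^bsub>VB n\<^esub> vb_sigma n i \<otimes>\<^bsub>VB n\<^esub> vb_rho n k"
      using c[OF ik(1)] c[OF ik(2)] by (intro intertwine_mult rr[OF ik] rs[OF ik]) auto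
  next
    fix i assume i: "1 \<le> i" "i + 1 < n"
    then have ci: "i \<in> {1..<n}" "i + 1 \<in> {1..<n}" by auto
    show "vb_rho n i \<otimes>\<^bsub>VB n\<^esub> vb_rho n (i+1) \<otimes>\<^bsub>VB n\<^esub> (vb_rho n i \<otimes>\<^bsub>VB n\<^esub> inv\<^bsub>VB n\<^esub> vb_sigma n i)
        = vb_rho n (i+1) \<otimes>\<^bsub>VB n\<^esub> inv\<^bsub>VB n\<^esub> vb_sigma n (i+1)
          \<otimes>\<^bsub>VB n\<^esub> (vb_rho n i \<otimes>\<^bsub>VB n\<^esub> vb_rho n (i+1))"
      using c[OF ci(1)] c[OF ci(2)] by (intro intertwine_mult sr[OF i] ss[OF i]) auto
  qed ((rule far adjacent_relations rho_square; assumption) | (intro m_closed inv_closed c; assumption))+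
  show "mixed_braid_relations (VB n) n (vb_rho n) (\<lambda>i. inv\<^bsub>VB n\<^esub> vb_sigma n i \<otimes>\<^bsub>VB n\<^esub> vb_rho n i)"
  proof (intro mixed_braid_relations.intro VB_group mixed_braid_relations_axioms.intro)
    fix i k assume ik: "i \<in> {1..<n}" "k \<in> {1..<n}" "\<bar>int i - int k\<bar> \<ge> 2"
    show "vb_rho n k \<otimes>\<^bsub>VB n\<^esub> (inv\<^bsub>VB n\<^esub> vb_sigma n i \<otimes>\<^bsub>VB n\<^esub> vb_rho n i)
        = inv\<^bsub>VB n\<^esub> vb_sigma n i \<otimes>\<^bsub>VB n\<^esub> vb_rho n i \<otimes>\<^bsub>VB n\<^esub> vb_rho n k"
      using c[OF ik(1)] c[OF ik(2)] by (intro intertwine_mult rr[OF ik] rs[OF ik]) auto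
  next
    fix i assume i: "1 \<le> i" "i + 1 < n"
    then have ci: "i \<in> {1..<n}" "i + 1 \<in> {1..<n}" by auto
    show "vb_rho n i \<otimes>\<^bsub>VB n\<^esub> vb_rho n (i+1) \<otimes>\<^bsub>VB n\<^esub> (inv\<^bsub>VB n\<^esub> vb_sigma n i \<otimes>\<^bsub>VB n\<^esub> vb_rho n i)
        = inv\<^bsub>VB n\<^esub> vb_sigma n (i+1) \<otimes>\<^bsub>VB n\<^esub> vb_rho n (i+1)
          \<otimes>\<^bsub>VB n\<^esub> (vb_rho n i \<otimes>\<^bsub>VB n\<^esub> vb_rho n (i+1))"
      using c[OF ci(1)] c[OF ci(2)] by (intro intertwine_mult sr[OF i] ss[OF i]) auto
  qed ((rule far adjacent_relations rho_square; assumption) | (intro m_closed inv_closed c; assumption))+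
qed

text \<open>For \<open>i < j\<close> and \<open>i > j\<close> this is the index computation above, applied to the families starting from
  \<open>\<lambda>\<^bsub>i,i+1\<^esub>\<close> and \<open>\<lambda>\<^bsub>i+1,i\<^esub>\<close>. On the adjacent pair that \<open>\<rho>\<^sub>k\<close> reverses, conjugation by the involution
  \<open>\<rho>\<^sub>k\<close> exchanges \<open>\<lambda>\<^bsub>k,k+1\<^esub>\<close> with \<open>\<lambda>\<^bsub>k+1,k\<^esub>\<close>.\<close>

lemma rho_conj_lambda:
  assumes ij: "(i, j) \<in> lam_idx n" and k: "k \<in> {1..<n}"
  shows "vb_rho n k \<otimes>\<^bsub>VB n\<^esub> vb_lambda n i j \<otimes>\<^bsub>VB n\<^esub> vb_rho n k
       = vb_lambda n (transpose k (k+1) i) (transpose k (k+1) j)"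
proof -
  interpret group "VB n" by (rule VB_group)
  interpret A: mixed_braid_relations "VB n" n "vb_rho n" "\<lambda>i. vb_rho n i \<otimes>\<^bsub>VB n\<^esub> inv\<^bsub>VB n\<^esub> vb_sigma n i"
    by (rule mixed_braid_relations_VB)
  interpret B: mixed_braid_relations "VB n" n "vb_rho n" "\<lambda>i. inv\<^bsub>VB n\<^esub> vb_sigma n i \<otimes>\<^bsub>VB n\<^esub> vb_rho n i"
    by (rule mixed_braid_relations_VB)
  have A: "vb_lambda n i j = A.transported i j" if "i < j" for i j
    using that by (simp add: vb_lambda_def A.transported_def vb_w_def Let_def)
  have B: "vb_lambda n j i = B.transported i j" if "i < j" for i j
    using that by (simp add: vb_lambda_def B.transported_def vb_w_def Let_def)
  note c = rho_closed[OF k] sigma_closed[OF k] rho_square[OF k]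
  have b: "1 \<le> i" "i \<le> n" "1 \<le> j" "j \<le> n" "i \<noteq> j" using ij by (auto simp: lam_idx_def)
  consider "i = k" "j = Suc k" | "j = k" "i = Suc k" | "i < j" "\<not> (i = k \<and> j = Suc k)"
    | "j < i" "\<not> (j = k \<and> i = Suc k)"
    using b by linarith
  then show ?thesis
  proof cases
    case 1
    then show ?thesis
      using A[of k "Suc k"] B[of k "Suc k"] A.transported_base[OF k] B.transported_base[OF k] c
      by (simp add: m_assoc[symmetric])
  next
    case 2
    then show ?thesis
      using A[of k "Suc k"] B[of k "Suc k"] A.transported_base[OF k] B.transported_base[OF k] c
      by (simp add: m_assoc)
  next
    case 3
    moreover have "transpose k (k+1) i < transpose k (k+1) j"
      using 3 by (auto simp: transpose_def)
    ultimately show ?thesis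
      using A.conj_r_transported[of i j k] b k A by (auto simp: A.conj_r_def)
  next
    case 4
    moreover have "transpose k (k+1) j < transpose k (k+1) i"
      using 4 by (auto simp: transpose_def)
    ultimately show ?thesis
      using B.conj_r_transported[of j i k] b k B by (auto simp: B.conj_r_def)
  qed
qed

section \<open>The action on the generators of the abelianised pure virtual braid group\<close>

lemma VP_normal: "VP n \<lhd> VB n"
  unfolding VP_def by (rule group_hom.normal_kernel[OF pi_p_hom])

lemma lambda_in_VP:
  assumes "(i, j) \<in> lam_idx n"
  shows "vb_lambda n i j \<in> VP n"
proof -
  interpret VB: group "VB n" by (rule VB_group)
  interpret pi: group_hom "VB n" "sym_group_lr n" "pi_p n" by (rule pi_p_hom)
  interpret VP: normal "VP n" "VB n" by (rule VP_normal)
  interpret vc: mixed_braid_relations "VB n" n "vb_rho n" "\<lambda>i. vb_rho n i \<otimes>\<^bsub>VB n\<^esub> inv\<^bsub>VB n\<^esub> vb_sigma n i"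
    by (rule mixed_braid_relations_VB)
  have b: "1 \<le> i" "i \<le> n" "1 \<le> j" "j \<le> n" "i \<noteq> j" using assms by (auto simp: lam_idx_def)
  have w: "vb_w n i j \<in> carrier (VB n)" if "j \<le> n" for i j
    unfolding vb_w_def using vc.w_closed[OF that, of i] by simp
  have base: "vb_rho n k \<otimes>\<^bsub>VB n\<^esub> inv\<^bsub>VB n\<^esub> vb_sigma n k \<in> VP n"
    "inv\<^bsub>VB n\<^esub> vb_sigma n k \<otimes>\<^bsub>VB n\<^esub> vb_rho n k \<in> VP n" if k: "k \<in> {1..<n}" for k
  proof -
    note c = rho_closed[OF k] sigma_closed[OF k]
    have eq: "pi_p n (vb_rho n k) = pi_p n (vb_sigma n k)"
      using pi_p_gens[of k n] k by simp
    have "pi_p n (vb_rho n k \<otimes>\<^bsub>VB n\<^esub> inv\<^bsub>VB n\<^esub> vb_sigma n k) = \<one>\<^bsub>sym_group_lr n\<^esub>"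
      "pi_p n (inv\<^bsub>VB n\<^esub> vb_sigma n k \<otimes>\<^bsub>VB n\<^esub> vb_rho n k) = \<one>\<^bsub>sym_group_lr n\<^esub>"
      using c pi.hom_closed[OF c(2)] by (simp_all add: eq)
    then show "vb_rho n k \<otimes>\<^bsub>VB n\<^esub> inv\<^bsub>VB n\<^esub> vb_sigma n k \<in> VP n"
      "inv\<^bsub>VB n\<^esub> vb_sigma n k \<otimes>\<^bsub>VB n\<^esub> vb_rho n k \<in> VP n"
      unfolding VP_def kernel_def using VB.m_closed VB.inv_closed c by blast+
  qed
  show ?thesis
  proof (cases "i < j")
    case True
    then show ?thesis
      using VP.inv_op_closed2[OF w base(1)] b by (simp add: vb_lambda_def)
  next
    case False
    then show ?thesis
      using VP.inv_op_closed2[OF w base(2)] b by (simp add: vb_lambda_def)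
  qed
qed

lemma Gamma2_normal: "Gamma2_VP n \<lhd> VB n"
  unfolding Gamma2_VP_def by (rule group.derived_is_normal[OF VB_group VP_normal])

lemma Gamma2_sub_VP: "Gamma2_VP n \<subseteq> VP n"
  unfolding Gamma2_VP_def
  by (rule group.derived_incl[OF VB_group]) (use VP_normal normal_imp_subgroup in blast)+

abbreviation vb_class :: "nat \<Rightarrow> vgen word set \<Rightarrow> vgen word set set"
  where "vb_class n g \<equiv> Gamma2_VP n #>\<^bsub>VB n\<^esub> g"

lemma vb_class_hom: "group_hom (VB n) (VBq n) (vb_class n)"
  unfolding group_hom_def group_hom_axioms_def VBq_def
  using Gamma2_normal
  by (simp add: VB_group normal.factorgroup_is_group normal.r_coset_hom_Mod)

lemma VBq_carrier: "carrier (VBq n) = vb_class n ` carrier (VB n)"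
  by (simp add: VBq_def carrier_FactGroup)

lemma VPq_carrier: "carrier (VPq n) = vb_class n ` VP n"
  by (auto simp: VPq_def carrier_FactGroup r_coset_def)

text \<open>The two quotients have literally the same operation and the same unit, so the quotient of \<open>VP\<^sub>n\<close> is the
  abelian normal subgroup to which the general conjugacy result is applied.\<close>

lemma VPq_sub_VBq: "VPq n = (VBq n)\<lparr>carrier := carrier (VPq n)\<rparr>"
  by (simp add: VPq_def VBq_def FactGroup_def set_mult_def fun_eq_iff)

lemma VPq_comm_group: "comm_group (VPq n)"
  unfolding VPq_def Gamma2_VP_def
  by (rule group.derived_quot_of_subgroup_is_comm_group[OF VB_group])
    (rule normal_imp_subgroup[OF VP_normal])

lemma VPq_normal: "carrier (VPq n) \<lhd> VBq n"
proof -
  interpret cl: group_hom "VB n" "VBq n" "vb_class n" by (rule vb_class_hom)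
  interpret VP: normal "VP n" "VB n" by (rule VP_normal)
  show ?thesis
  proof (rule cl.H.normal_invI)
    show "subgroup (carrier (VPq n)) (VBq n)"
      unfolding VPq_carrier by (rule cl.subgroup_img_is_subgroup[OF VP.subgroup_axioms])
    fix h x assume "h \<in> carrier (VPq n)" "x \<in> carrier (VBq n)"
    then obtain p g where "p \<in> VP n" "h = vb_class n p" "g \<in> carrier (VB n)" "x = vb_class n g"
      by (auto simp: VPq_carrier VBq_carrier)
    then show "x \<otimes>\<^bsub>VBq n\<^esub> h \<otimes>\<^bsub>VBq n\<^esub> inv\<^bsub>VBq n\<^esub> x \<in> carrier (VPq n)"
      unfolding VPq_carrier
      by (auto intro!: image_eqI[of _ _ "g \<otimes>\<^bsub>VB n\<^esub> p \<otimes>\<^bsub>VB n\<^esub> inv\<^bsub>VB n\<^esub> g"] VP.inv_op_closed2)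
  qed
qed

lemma lam_in_VPq: "(i, j) \<in> lam_idx n \<Longrightarrow> lam n i j \<in> carrier (VPq n)"
  using lambda_in_VP by (auto simp: VPq_carrier lam_def)

lemma lam_closed: "(i, j) \<in> lam_idx n \<Longrightarrow> lam n i j \<in> carrier (VBq n)"
  using lam_in_VPq subgroup.subset[OF normal_imp_subgroup[OF VPq_normal]] by blast

lemma pi_bar_class:
  assumes "g \<in> carrier (VB n)"
  shows "pi_bar n (vb_class n g) = pi_p n g"
proof -
  interpret pi: group_hom "VB n" "sym_group_lr n" "pi_p n" by (rule pi_p_hom)
  have d: "pi_p n (d \<otimes>\<^bsub>VB n\<^esub> g) = pi_p n g" if "d \<in> Gamma2_VP n" for d
  proof -
    have "d \<in> carrier (VB n)" "pi_p n d = \<one>\<^bsub>sym_group_lr n\<^esub>"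
      using that Gamma2_sub_VP by (auto simp: VP_def kernel_def)
    then show ?thesis using assms by simp
  qed
  have "g \<in> vb_class n g"
    using normal_imp_subgroup[OF Gamma2_normal] assms by (rule group.rcos_self[OF VB_group, rotated])
  moreover have "pi_p n y = pi_p n g" if "y \<in> vb_class n g" for y
    using that d unfolding r_coset_def by blast
  ultimately have "pi_p n ` vb_class n g = {pi_p n g}" by blast
  then show ?thesis by (simp add: pi_bar_def)
qed

lemma sym_lr_permutes: "p \<in> carrier (sym_group_lr n) \<longleftrightarrow> p permutes {1..n}"
  by (simp add: sym_group_lr_def sym_group_def)

lemma permute_lam_idx:
  assumes "p permutes {1..n}"
  shows "(p i, p j) \<in> lam_idx n \<longleftrightarrow> (i, j) \<in> lam_idx n"
  using permutes_in_image[OF assms, of i] permutes_in_image[OF assms, of j]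
    inj_eq[OF permutes_inj[OF assms], of i j]
  by (auto simp: lam_idx_def)

text \<open>Conjugation in \<open>VB\<^sub>n / \<Gamma>\<^sub>2(VP\<^sub>n)\<close> permutes the indices of the \<open>\<lambda>\<^bsub>i,j\<^esub>\<close>. Written as an intertwining relation
  with \<open>\<pi>\<^sub>p(g)\<close> on the left-hand side, instead of a conjugation with the inverse permutation on the right,
  this is visibly multiplicative in \<open>g\<close>, so it suffices to check the generators and their inverses. For \<open>\<rho>\<^sub>k\<close> it
  holds already in \<open>VB\<^sub>n\<close>. For \<open>\<sigma>\<^sub>k\<close>, which is \<open>\<rho>\<^sub>k\<close> multiplied on the left by the inverse of
  \<open>\<lambda>\<^bsub>k,k+1\<^esub>\<close>, the quotient comes in: there the additional factor commutes with every \<open>\<lambda>\<^bsub>i,j\<^esub>\<close>.\<close>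

lemma lam_intertwine:
  assumes "g \<in> carrier (VB n)" "(i, j) \<in> lam_idx n"
  shows "vb_class n g \<otimes>\<^bsub>VBq n\<^esub> lam n (pi_p n g i) (pi_p n g j) = lam n i j \<otimes>\<^bsub>VBq n\<^esub> vb_class n g"
proof -
  interpret VB: group "VB n" by (rule VB_group)
  interpret pi: group_hom "VB n" "sym_group_lr n" "pi_p n" by (rule pi_p_hom)
  interpret cl: group_hom "VB n" "VBq n" "vb_class n" by (rule vb_class_hom)
  have perm: "pi_p n g permutes {1..n}" if "g \<in> carrier (VB n)" for g
    using pi.hom_closed[OF that] by (simp add: sym_lr_permutes)
  note lam = lam_closed
  have lambda: "vb_lambda n i j \<in> carrier (VB n)" if "(i, j) \<in> lam_idx n" for i j
    using lambda_in_VP[OF that] by (simp add: VP_def kernel_def)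
  let ?P = "\<lambda>g. \<forall>i j. (i, j) \<in> lam_idx n \<longrightarrow>
    vb_class n g \<otimes>\<^bsub>VBq n\<^esub> lam n (pi_p n g i) (pi_p n g j) = lam n i j \<otimes>\<^bsub>VBq n\<^esub> vb_class n g"
  have rho: "?P (vb_rho n k)" if k: "k \<in> {1..<n}" for k
  proof (intro allI impI)
    fix i j assume ij: "(i, j) \<in> lam_idx n"
    let ?t = "transpose k (k+1)"
    have pi: "pi_p n (vb_rho n k) = ?t" using pi_p_gens[of k n] k by simp
    have t: "(?t i, ?t j) \<in> lam_idx n"
      using permute_lam_idx[OF perm[OF rho_closed[OF k]]] ij by (simp add: pi)
    have "vb_rho n k \<otimes>\<^bsub>VB n\<^esub> vb_lambda n (?t i) (?t j) =
        vb_rho n k \<otimes>\<^bsub>VB n\<^esub> vb_rho n k \<otimes>\<^bsub>VB n\<^esub> vb_lambda n i j \<otimes>\<^bsub>VB n\<^esub> vb_rho n k"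
      using rho_conj_lambda[OF ij k, symmetric] rho_closed[OF k] lambda[OF ij]
      by (simp add: VB.m_assoc)
    also have "\<dots> = vb_lambda n i j \<otimes>\<^bsub>VB n\<^esub> vb_rho n k"
      using rho_square[OF k] lambda[OF ij] by simp
    finally have "vb_class n (vb_rho n k \<otimes>\<^bsub>VB n\<^esub> vb_lambda n (?t i) (?t j))
        = vb_class n (vb_lambda n i j \<otimes>\<^bsub>VB n\<^esub> vb_rho n k)" by simp
    then show "vb_class n (vb_rho n k) \<otimes>\<^bsub>VBq n\<^esub> lam n (pi_p n (vb_rho n k) i) (pi_p n (vb_rho n k) j)
        = lam n i j \<otimes>\<^bsub>VBq n\<^esub> vb_class n (vb_rho n k)"
      using rho_closed[OF k] lambda[OF ij] lambda[OF t] by (simp add: lam_def pi)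
  qed
  have sigma: "?P (vb_sigma n k)" if k: "k \<in> {1..<n}" for k
  proof (intro allI impI)
    fix i j assume ij: "(i, j) \<in> lam_idx n"
    let ?t = "transpose k (k+1)"
    let ?L = "lam n k (k+1)"
    have pi: "pi_p n (vb_rho n k) = ?t" "pi_p n (vb_sigma n k) = ?t" using pi_p_gens[of k n] k by simp_all
    have t: "(?t i, ?t j) \<in> lam_idx n"
      using permute_lam_idx[OF perm[OF rho_closed[OF k]]] ij by (simp add: pi)
    have kk: "(k, k+1) \<in> lam_idx n" using k by (auto simp: lam_idx_def)
    note c = rho_closed[OF k] sigma_closed[OF k]
    have "vb_lambda n k (k+1) = vb_rho n k \<otimes>\<^bsub>VB n\<^esub> inv\<^bsub>VB n\<^esub> vb_sigma n k"
      using c by (simp add: vb_lambda_def vb_w_def)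
    then have "vb_sigma n k = inv\<^bsub>VB n\<^esub> vb_lambda n k (k+1) \<otimes>\<^bsub>VB n\<^esub> vb_rho n k"
      using c by (simp add: VB.inv_mult_group VB.m_assoc)
    then have s: "vb_class n (vb_sigma n k) = inv\<^bsub>VBq n\<^esub> ?L \<otimes>\<^bsub>VBq n\<^esub> vb_class n (vb_rho n k)"
      using c lambda[OF kk] by (simp add: lam_def)
    have comm: "inv\<^bsub>VBq n\<^esub> ?L \<otimes>\<^bsub>VBq n\<^esub> lam n i j = lam n i j \<otimes>\<^bsub>VBq n\<^esub> inv\<^bsub>VBq n\<^esub> ?L"
    proof -
      have "lam n i j \<otimes>\<^bsub>VBq n\<^esub> ?L = ?L \<otimes>\<^bsub>VBq n\<^esub> lam n i j"
        using comm_groupE(4)[OF VPq_comm_group lam_in_VPq[OF ij] lam_in_VPq[OF kk]]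
        by (simp add: VPq_def VBq_def set_mult_def)
      then show ?thesis
        using cl.H.intertwine_inv[of "lam n i j" ?L ?L] lam[OF ij] lam[OF kk] by simp
    qed
    show "vb_class n (vb_sigma n k) \<otimes>\<^bsub>VBq n\<^esub> lam n (pi_p n (vb_sigma n k) i) (pi_p n (vb_sigma n k) j)
        = lam n i j \<otimes>\<^bsub>VBq n\<^esub> vb_class n (vb_sigma n k)"
    proof -
      let ?r = "vb_class n (vb_rho n k)"
      have cc: "?r \<in> carrier (VBq n)" "lam n (?t i) (?t j) \<in> carrier (VBq n)"
        "lam n i j \<in> carrier (VBq n)" "inv\<^bsub>VBq n\<^esub> ?L \<in> carrier (VBq n)"
        using c lam[OF t] lam[OF ij] lam[OF kk] by auto
      have r: "?r \<otimes>\<^bsub>VBq n\<^esub> lam n (?t i) (?t j) = lam n i j \<otimes>\<^bsub>VBq n\<^esub> ?r"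
        using rho[OF k] ij unfolding pi by blast
      have "inv\<^bsub>VBq n\<^esub> ?L \<otimes>\<^bsub>VBq n\<^esub> ?r \<otimes>\<^bsub>VBq n\<^esub> lam n (?t i) (?t j)
          = inv\<^bsub>VBq n\<^esub> ?L \<otimes>\<^bsub>VBq n\<^esub> lam n i j \<otimes>\<^bsub>VBq n\<^esub> ?r"
        using cc by (simp only: cl.H.m_assoc r)
      also have "\<dots> = lam n i j \<otimes>\<^bsub>VBq n\<^esub> (inv\<^bsub>VBq n\<^esub> ?L \<otimes>\<^bsub>VBq n\<^esub> ?r)"
        unfolding comm using cc by (simp only: cl.H.m_assoc)
      finally show ?thesis unfolding s pi .
    qed
  qed
  have gen: "?P x" "x \<in> carrier (VB n)"
    if x: "x \<in> presented_gen (vb_gens n) (vb_rels n) ` vb_gens n" for x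
  proof -
    obtain y where y: "y \<in> vb_gens n" "x = presented_gen (vb_gens n) (vb_rels n) y"
      using x by blast
    obtain k where "k \<in> {1..<n}" "y = Rh k \<or> y = Sg k"
      using y(1) unfolding vb_gens_def by blast
    then have k: "k \<in> {1..<n}" "x = vb_rho n k \<or> x = vb_sigma n k"
      using y(2) unfolding vb_rho_def vb_sigma_def by blast+
    show "?P x" "x \<in> carrier (VB n)"
      using k(2) rho[OF k(1)] sigma[OF k(1)] rho_closed[OF k(1)] sigma_closed[OF k(1)] by blast+
  qed
  have mult_lr: "(p \<otimes>\<^bsub>sym_group_lr n\<^esub> q) i = q (p i)" for p q i
    by (simp add: sym_group_lr_def)
  have one_lr: "\<one>\<^bsub>sym_group_lr n\<^esub> i = i" for i
    by (simp add: sym_group_lr_def sym_group_def)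
  have "g \<in> generate (VB n) (presented_gen (vb_gens n) (vb_rels n) ` vb_gens n)"
    using assms(1) presented_group_generated[OF vb_rels_words, of n] by (simp add: VB_def)
  then have "g \<in> carrier (VB n) \<and> ?P g"
  proof induction
    case one
    then show ?case using lam by (simp add: one_lr)
  next
    case (incl h)
    then show ?case using gen by blast
  next
    case (inv h)
    have h: "h \<in> carrier (VB n)" "?P h" using gen[OF inv] by auto
    have "vb_class n (inv\<^bsub>VB n\<^esub> h) \<otimes>\<^bsub>VBq n\<^esub> lam n (pi_p n (inv\<^bsub>VB n\<^esub> h) i) (pi_p n (inv\<^bsub>VB n\<^esub> h) j)
        = lam n i j \<otimes>\<^bsub>VBq n\<^esub> vb_class n (inv\<^bsub>VB n\<^esub> h)" if ij: "(i, j) \<in> lam_idx n" for i j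
    proof -
      let ?p = "pi_p n (inv\<^bsub>VB n\<^esub> h)"
      have p: "(?p i, ?p j) \<in> lam_idx n"
        using permute_lam_idx[OF perm[OF VB.inv_closed[OF h(1)]]] ij by blast
      have inv: "pi_p n h (?p x) = x" for x
        using h mult_lr[of ?p "pi_p n h" x] pi.hom_closed[OF h(1)]
        by (simp add: one_lr)
      have *: "vb_class n h \<otimes>\<^bsub>VBq n\<^esub> lam n i j = lam n (?p i) (?p j) \<otimes>\<^bsub>VBq n\<^esub> vb_class n h"
        using h(2)[rule_format, OF p] by (simp add: inv)
      let ?h = "vb_class n h"
      have c: "?h \<in> carrier (VBq n)" "lam n i j \<in> carrier (VBq n)" "lam n (?p i) (?p j) \<in> carrier (VBq n)"
        using lam[OF ij] lam[OF p] h by auto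
      have "inv\<^bsub>VBq n\<^esub> ?h \<otimes>\<^bsub>VBq n\<^esub> lam n (?p i) (?p j)
          = inv\<^bsub>VBq n\<^esub> ?h \<otimes>\<^bsub>VBq n\<^esub> (lam n (?p i) (?p j) \<otimes>\<^bsub>VBq n\<^esub> ?h) \<otimes>\<^bsub>VBq n\<^esub> inv\<^bsub>VBq n\<^esub> ?h"
        using c by (simp add: cl.H.m_assoc)
      also have "\<dots> = lam n i j \<otimes>\<^bsub>VBq n\<^esub> inv\<^bsub>VBq n\<^esub> ?h"
        unfolding *[symmetric] using c by (simp add: cl.H.m_assoc cl.H.inv_cancel)
      finally show ?thesis using h by simp
    qed
    then show ?case using h by blast
  next
    case (eng g h)
    then have c: "g \<in> carrier (VB n)" "h \<in> carrier (VB n)" by auto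
    have "vb_class n (g \<otimes>\<^bsub>VB n\<^esub> h) \<otimes>\<^bsub>VBq n\<^esub> lam n (pi_p n (g \<otimes>\<^bsub>VB n\<^esub> h) i) (pi_p n (g \<otimes>\<^bsub>VB n\<^esub> h) j)
        = lam n i j \<otimes>\<^bsub>VBq n\<^esub> vb_class n (g \<otimes>\<^bsub>VB n\<^esub> h)" if ij: "(i, j) \<in> lam_idx n" for i j
    proof -
      let ?i = "pi_p n g i" and ?j = "pi_p n g j"
      have ij': "(?i, ?j) \<in> lam_idx n" using permute_lam_idx[OF perm[OF c(1)]] ij by blast
      have ij'': "(pi_p n h ?i, pi_p n h ?j) \<in> lam_idx n" using permute_lam_idx[OF perm[OF c(2)]] ij' by blast
      note cc = lam[OF ij] lam[OF ij'] lam[OF ij''] cl.hom_closed[OF c(1)] cl.hom_closed[OF c(2)]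
      have "vb_class n g \<otimes>\<^bsub>VBq n\<^esub> vb_class n h \<otimes>\<^bsub>VBq n\<^esub> lam n (pi_p n h ?i) (pi_p n h ?j)
          = vb_class n g \<otimes>\<^bsub>VBq n\<^esub> (lam n ?i ?j \<otimes>\<^bsub>VBq n\<^esub> vb_class n h)"
        using eng.IH(2) ij' cc by (simp only: cl.H.m_assoc)
      also have "\<dots> = vb_class n g \<otimes>\<^bsub>VBq n\<^esub> lam n ?i ?j \<otimes>\<^bsub>VBq n\<^esub> vb_class n h"
        using cc by (simp only: cl.H.m_assoc)
      also have "\<dots> = lam n i j \<otimes>\<^bsub>VBq n\<^esub> vb_class n g \<otimes>\<^bsub>VBq n\<^esub> vb_class n h"
        using eng.IH(1) ij by simp
      finally show ?thesis using c cc by (simp add: mult_lr cl.H.m_assoc)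
    qed
    then show ?case using c by auto
  qed
  then show ?thesis using assms(2) by blast
qed

text \<open>The \<open>k\<close>-th power of \<open>\<nu>\<close> acts on the indices as the \<open>k\<close>-th power of \<open>\<theta>\<close>, so the orbit described by indices is
  the orbit under conjugation, whichever pair \<open>(i, j)\<close> is chosen to represent \<open>x\<close>.\<close>

lemma lam_orbit_eq:
  assumes "\<nu> \<in> carrier (VBq n)" and \<theta>: "\<theta> = inv\<^bsub>sym_group_lr n\<^esub> (pi_bar n \<nu>)" and x: "x \<in> lam_set n"
  shows "lam_orbit n \<theta> x = {g \<otimes>\<^bsub>VBq n\<^esub> x \<otimes>\<^bsub>VBq n\<^esub> inv\<^bsub>VBq n\<^esub> g | g. g \<in> generate (VBq n) {\<nu>}}"
proof -
  interpret pi: group_hom "VB n" "sym_group_lr n" "pi_p n" by (rule pi_p_hom)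
  interpret cl: group_hom "VB n" "VBq n" "vb_class n" by (rule vb_class_hom)
  obtain g where g: "g \<in> carrier (VB n)" "\<nu> = vb_class n g"
    using assms(1) by (auto simp: VBq_carrier)
  have pow: "\<nu> [^]\<^bsub>VBq n\<^esub> k = vb_class n (g [^]\<^bsub>VB n\<^esub> k)" for k :: int
    unfolding g(2) by (rule cl.hom_int_pow[OF g(1), symmetric])
  have conj: "\<nu> [^]\<^bsub>VBq n\<^esub> k \<otimes>\<^bsub>VBq n\<^esub> lam n i j \<otimes>\<^bsub>VBq n\<^esub> inv\<^bsub>VBq n\<^esub> (\<nu> [^]\<^bsub>VBq n\<^esub> k)
      = lam n ((\<theta> [^]\<^bsub>sym_group_lr n\<^esub> k) i) ((\<theta> [^]\<^bsub>sym_group_lr n\<^esub> k) j)"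
    if ij: "(i, j) \<in> lam_idx n" for i j and k :: int
  proof -
    let ?p = "\<theta> [^]\<^bsub>sym_group_lr n\<^esub> k" and ?g = "g [^]\<^bsub>VB n\<^esub> k"
    have "?p = inv\<^bsub>sym_group_lr n\<^esub> (pi_p n ?g)"
      using g by (simp add: \<theta> pi_bar_class pi.hom_int_pow pi.H.int_pow_inv)
    then have p: "?p \<in> carrier (sym_group_lr n)" "?p \<otimes>\<^bsub>sym_group_lr n\<^esub> pi_p n ?g = \<one>\<^bsub>sym_group_lr n\<^esub>"
      using g pi.hom_closed[of ?g] by simp_all
    have inv: "pi_p n ?g (?p x) = x" for x
      using fun_cong[OF p(2), of x] by (simp add: sym_group_lr_def sym_group_def)
    have pij: "(?p i, ?p j) \<in> lam_idx n"
      using permute_lam_idx p(1) ij by (simp add: sym_lr_permutes)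
    show ?thesis
      using lam_closed[OF pij] lam_intertwine[OF _ pij, of ?g] g(1) by (simp add: inv pow cl.H.m_assoc del: cl.hom_int_pow)
  qed
  have gen: "g \<in> generate (VBq n) {\<nu>} \<longleftrightarrow> (\<exists>k::int. g = \<nu> [^]\<^bsub>VBq n\<^esub> k)" for g
    unfolding cl.H.generate_pow[OF assms(1)] by blast
  show ?thesis
  proof (intro equalityI subsetI)
    fix y assume "y \<in> lam_orbit n \<theta> x"
    then obtain i j and k :: int where
      "y = lam n ((\<theta> [^]\<^bsub>sym_group_lr n\<^esub> k) i) ((\<theta> [^]\<^bsub>sym_group_lr n\<^esub> k) j)" "(i, j) \<in> lam_idx n" "x = lam n i j"
      unfolding lam_orbit_def by blast
    then have "y = \<nu> [^]\<^bsub>VBq n\<^esub> k \<otimes>\<^bsub>VBq n\<^esub> x \<otimes>\<^bsub>VBq n\<^esub> inv\<^bsub>VBq n\<^esub> (\<nu> [^]\<^bsub>VBq n\<^esub> k)"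
      by (simp only: conj)
    then show "y \<in> {g \<otimes>\<^bsub>VBq n\<^esub> x \<otimes>\<^bsub>VBq n\<^esub> inv\<^bsub>VBq n\<^esub> g | g. g \<in> generate (VBq n) {\<nu>}}"
      using gen by blast
  next
    fix y assume "y \<in> {g \<otimes>\<^bsub>VBq n\<^esub> x \<otimes>\<^bsub>VBq n\<^esub> inv\<^bsub>VBq n\<^esub> g | g. g \<in> generate (VBq n) {\<nu>}}"
    then obtain h where h: "h \<in> generate (VBq n) {\<nu>}" "y = h \<otimes>\<^bsub>VBq n\<^esub> x \<otimes>\<^bsub>VBq n\<^esub> inv\<^bsub>VBq n\<^esub> h"
      by (elim CollectE exE conjE)
    obtain k :: int where k: "h = \<nu> [^]\<^bsub>VBq n\<^esub> k"
      using h(1) unfolding gen by (elim exE)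
    obtain i j where ij: "(i, j) \<in> lam_idx n" "x = lam n i j"
      using x unfolding lam_set_def by blast
    have "y = lam n ((\<theta> [^]\<^bsub>sym_group_lr n\<^esub> k) i) ((\<theta> [^]\<^bsub>sym_group_lr n\<^esub> k) j)"
      unfolding h(2) k ij(2) by (rule conj[OF ij(1)])
    then show "y \<in> lam_orbit n \<theta> x"
      unfolding lam_orbit_def using ij by blast
  qed
qed

text \<open>A transversal has one element in the orbit of \<open>x\<close>; since orbits are symmetric, this says equally that
  \<open>x\<close> lies in the orbit of exactly one element of the transversal.\<close>

lemma transversal_unique:
  assumes "\<nu> \<in> carrier (VBq n)" "lam_transversal n \<nu> T" "x \<in> lam_set n"
  shows "\<exists>!t. t \<in> T \<and> x \<in> {g \<otimes>\<^bsub>VBq n\<^esub> t \<otimes>\<^bsub>VBq n\<^esub> inv\<^bsub>VBq n\<^esub> g | g. g \<in> generate (VBq n) {\<nu>}}"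
proof -
  interpret cl: group_hom "VB n" "VBq n" "vb_class n" by (rule vb_class_hom)
  let ?O = "\<lambda>x. {g \<otimes>\<^bsub>VBq n\<^esub> x \<otimes>\<^bsub>VBq n\<^esub> inv\<^bsub>VBq n\<^esub> g | g. g \<in> generate (VBq n) {\<nu>}}"
  have car: "x \<in> carrier (VBq n)" if "x \<in> lam_set n" for x
    using that lam_closed unfolding lam_set_def by blast
  have gen: "generate (VBq n) {\<nu>} \<subseteq> carrier (VBq n)"
    using assms(1) by (intro cl.H.generate_incl) auto
  have T: "T \<subseteq> lam_set n"
    using assms(2) by (auto simp: lam_transversal_def is_transversal_def)
  have sym: "y \<in> ?O x" if xy: "x \<in> ?O y" "y \<in> carrier (VBq n)" for x y
  proof -
    obtain g where g: "g \<in> generate (VBq n) {\<nu>}" "x = g \<otimes>\<^bsub>VBq n\<^esub> y \<otimes>\<^bsub>VBq n\<^esub> inv\<^bsub>VBq n\<^esub> g"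
      using xy by blast
    have i: "inv\<^bsub>VBq n\<^esub> g \<in> generate (VBq n) {\<nu>}"
      using cl.H.generate_m_inv_closed[of "{\<nu>}" g] assms(1) g(1) by simp
    have "y = inv\<^bsub>VBq n\<^esub> g \<otimes>\<^bsub>VBq n\<^esub> x \<otimes>\<^bsub>VBq n\<^esub> inv\<^bsub>VBq n\<^esub> (inv\<^bsub>VBq n\<^esub> g)"
      using g gen xy(2) by (auto simp: subset_iff cl.H.m_assoc cl.H.inv_cancel)
    then show ?thesis using i by blast
  qed
  have "orbit ((VBq n)\<lparr>carrier := generate (VBq n) {\<nu>}\<rparr>)
      (\<lambda>g. \<lambda>x \<in> lam_set n. g \<otimes>\<^bsub>VBq n\<^esub> x \<otimes>\<^bsub>VBq n\<^esub> inv\<^bsub>VBq n\<^esub> g) x = ?O x"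
    using assms(3) by (simp add: orbit_def)
  then have "?O x \<in> orbits ((VBq n)\<lparr>carrier := generate (VBq n) {\<nu>}\<rparr>) (lam_set n)
      (\<lambda>g. \<lambda>x \<in> lam_set n. g \<otimes>\<^bsub>VBq n\<^esub> x \<otimes>\<^bsub>VBq n\<^esub> inv\<^bsub>VBq n\<^esub> g)"
    using assms(3) unfolding orbits_def by blast
  then have ex: "\<exists>!t. t \<in> T \<inter> ?O x"
    by (rule bspec[OF assms(2)[unfolded lam_transversal_def is_transversal_def, THEN conjunct2]])
  have "t \<in> T \<and> x \<in> ?O t \<longleftrightarrow> t \<in> T \<inter> ?O x" for t
  proof -
    have "t \<in> T \<Longrightarrow> x \<in> ?O t \<longleftrightarrow> t \<in> ?O x"
      using sym[OF _ car[OF assms(3)], of t] sym[OF _ car[of t], of x] T by (metis (lifting) subsetD)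
    then show ?thesis by (simp only: Int_iff cong: conj_cong)
  qed
  then show ?thesis using ex by (simp only:)
qed

section \<open>Conjugate elements of the quotient group\<close>

theorem theorem3p7:
  fixes n :: nat and \<sigma> :: "vgen word set set" and \<theta> :: "nat \<Rightarrow> nat"
    and T :: "vgen word set set set" and a :: "nat \<Rightarrow> nat \<Rightarrow> int"
  assumes "n \<ge> 2"
    and "\<sigma> \<in> carrier (VBq n)"
    and "\<theta> = inv\<^bsub>sym_group_lr n\<^esub> (pi_bar n \<sigma>)"
    and "lam_transversal n \<sigma> T"
  shows "conjugate_in (VBq n)
    (finprod (VPq n) (\<lambda>(i, j). lam n i j [^]\<^bsub>VPq n\<^esub> a i j) (lam_idx n) \<otimes>\<^bsub>VBq n\<^esub> \<sigma>)
    ((\<Otimes>\<^bsub>VPq n\<^esub> x \<in> T. x [^]\<^bsub>VPq n\<^esub> (\<Sum>(r, s) | (r, s) \<in> lam_idx n \<and> lam n r s \<in> lam_orbit n \<theta> x. a r s))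
       \<otimes>\<^bsub>VBq n\<^esub> \<sigma>)"
proof -
  let ?lam = "\<lambda>(i, j). lam n i j"
  have "comm_group ((VBq n)\<lparr>carrier := carrier (VPq n)\<rparr>)"
    unfolding VPq_sub_VBq[symmetric] by (rule VPq_comm_group)
  then interpret abelian_normal "carrier (VPq n)" "VBq n" \<sigma>
    using VPq_normal assms(2)
    by (simp add: abelian_normal_def abelian_normal_axioms_def)
  have fin: "finite (lam_idx n)"
    by (rule finite_subset[of _ "{1..n} \<times> {1..n}"]) (auto simp: lam_idx_def)
  have lam_set: "lam_set n = ?lam ` lam_idx n"
    by (auto simp: lam_set_def)
  have T: "T \<subseteq> lam_set n"
    using assms(4) by (auto simp: lam_transversal_def is_transversal_def)
  have "finite T" using T fin unfolding lam_set by (auto intro: finite_subset)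
  moreover have "?lam \<in> lam_idx n \<rightarrow> carrier (VPq n)" using lam_in_VPq by auto
  moreover have "T \<subseteq> carrier (VPq n)" using T lam_in_VPq unfolding lam_set by auto
  moreover have orb: "lam_orbit n \<theta> t =
      {g \<otimes>\<^bsub>VBq n\<^esub> t \<otimes>\<^bsub>VBq n\<^esub> inv\<^bsub>VBq n\<^esub> g | g. g \<in> generate (VBq n) {\<sigma>}}" if "t \<in> T" for t
    using lam_orbit_eq[OF assms(2,3)] T that by blast
  moreover have "\<exists>!t. t \<in> T \<and> ?lam p \<in> lam_orbit n \<theta> t" if "p \<in> lam_idx n" for p
  proof -
    have "?lam p \<in> lam_set n" using that unfolding lam_set by blast
    from transversal_unique[OF assms(2,4) this] show ?thesis
      using orb by (metis (no_types, lifting))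
  qed
  ultimately have "conjugate_in (VBq n)
      (finprod H (\<lambda>p. ?lam p [^]\<^bsub>H\<^esub> (case_prod a p)) (lam_idx n) \<otimes>\<^bsub>VBq n\<^esub> \<sigma>)
      (finprod H (\<lambda>t. t [^]\<^bsub>H\<^esub> (\<Sum>p | p \<in> lam_idx n \<and> ?lam p \<in> lam_orbit n \<theta> t. case_prod a p)) T
        \<otimes>\<^bsub>VBq n\<^esub> \<sigma>)"
    by (intro conjugate_collect_orbits fin)
  moreover have "{(r, s). (r, s) \<in> lam_idx n \<and> lam n r s \<in> X} = {p. p \<in> lam_idx n \<and> ?lam p \<in> X}" for X
    by auto
  moreover have "(\<lambda>p. ?lam p [^]\<^bsub>H\<^esub> (case_prod a p)) = (\<lambda>(i, j). lam n i j [^]\<^bsub>H\<^esub> a i j)"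
    by (simp add: fun_eq_iff)
  ultimately show ?thesis
    unfolding VPq_sub_VBq[of n, symmetric] by simp
qed

end
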